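(* Let $r \ge 1$ and let $W$ be an $r \times 3$ storage area whose open side is its bottom (front) row. For every number of loads $n \le 3r$ and every arrival sequence $A$ (a permutation of $\{1,\dots,n\}$), with departure sequence $D=(1,\dots,n)$, there is a solution that avoids relocations, i.e. a sequence of exactly $2n$ actions that first stores all loads in the order $A$ and then retrieves them in the order $D$, without any relocation. Moreover, given $A$ and $D$, such a solution can be found in $O(n)$ time.
   Context: Storage area: a rectangular grid $W$ with $r$ rows and $c$ columns (here $c=3$); the bottom row (front row) is the only side through which loads enter and leave. There are $n \le rc$ loads with distinct labels $1,\dots,n$, each occupying exactly one cell; no two loads share a cell. A load moves only along paths of horizontally/vertically adjacent cells (moves up, down, left, right) that are currently empty (apart from the load's own starting cell). Actions: (Storage) an arriving load is placed in an empty cell $v$ via a path from any cell of the front row to $v$. (Retrieval) a load is removed via a path from its current cell to any cell of the front row. (Relocation) a load is moved inside $W$ from its current cell to an empty cell $v$ via a path, where $v$ and the original cell must be accessible from the front row. Loads arrive one at a time in the order $A=(a_1,\dots,a_n)$, each being stored before the next arrives; after all are stored, they are retrieved in the order of the departure sequence $D$, which is fixed to be $(1,\dots,n)$ by relabeling. Offline setting: both $A$ and $D$ are known in advance. Finding a solution means determining the cell of $W$ in which each load is to be stored (the arrangement), such that storage in order $A$ and retrieval in order $D$ are possible with one action per load each. *)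

theory Defs
  imports Complex_Main "HOL-Library.Landau_Symbols"
begin

text \<open>Loads are named by their labels. A cell is a pair (row, column), both counted from 0;
  row 0 is the front row.\<close>

type_synonym load = nat
type_synonym cell = "nat \<times> nat"

definition area :: "nat \<Rightarrow> nat \<Rightarrow> cell set" where
  "area r c = {..<r} \<times> {..<c}"

definition front_row :: "nat \<Rightarrow> nat \<Rightarrow> cell set" where
  "front_row r c = {v \<in> area r c. fst v = 0}"

fun adjacent :: "cell \<Rightarrow> cell \<Rightarrow> bool" where
  "adjacent (i, j) (i', j') \<longleftrightarrow>
     (i = i' \<and> (j' = Suc j \<or> j = Suc j')) \<or> (j = j' \<and> (i' = Suc i \<or> i = Suc i'))"

definition reachable :: "cell set \<Rightarrow> cell \<Rightarrow> cell \<Rightarrow> bool" where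
  "reachable S u v \<longleftrightarrow>
     (\<exists>p. p \<noteq> [] \<and> hd p = u \<and> last p = v \<and> set p \<subseteq> S \<and> successively adjacent p)"

text \<open>A configuration maps each load currently in the area to its cell.\<close>

type_synonym config = "load \<rightharpoonup> cell"

definition empty_cells :: "nat \<Rightarrow> nat \<Rightarrow> config \<Rightarrow> cell set" where
  "empty_cells r c \<sigma> = area r c - ran \<sigma>"

datatype action = Storage load cell | Retrieval load | Relocation load cell

text \<open>The cell \<open>u\<close> of the moving load is added to the empty cells along which it may move.\<close>

inductive step :: "nat \<Rightarrow> nat \<Rightarrow> config \<Rightarrow> action \<Rightarrow> config \<Rightarrow> bool" for r c where
  Storage: "\<lbrakk>l \<notin> dom \<sigma>; e \<in> front_row r c; reachable (empty_cells r c \<sigma>) e v\<rbrakk>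
     \<Longrightarrow> step r c \<sigma> (Storage l v) (\<sigma>(l \<mapsto> v))"
| Retrieval: "\<lbrakk>\<sigma> l = Some u; e \<in> front_row r c;
     reachable (insert u (empty_cells r c \<sigma>)) u e\<rbrakk>
     \<Longrightarrow> step r c \<sigma> (Retrieval l) (\<sigma>(l := None))"
| Relocation: "\<lbrakk>\<sigma> l = Some u; v \<in> empty_cells r c \<sigma>;
     reachable (insert u (empty_cells r c \<sigma>)) u v;
     e \<in> front_row r c; reachable (insert u (empty_cells r c \<sigma>)) e u;
     e' \<in> front_row r c; reachable (insert u (empty_cells r c \<sigma>)) e' v\<rbrakk>
     \<Longrightarrow> step r c \<sigma> (Relocation l v) (\<sigma>(l \<mapsto> v))"

fun executes :: "nat \<Rightarrow> nat \<Rightarrow> config \<Rightarrow> action list \<Rightarrow> config \<Rightarrow> bool" where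
  "executes r c \<sigma> [] \<sigma>' \<longleftrightarrow> \<sigma> = \<sigma>'"
| "executes r c \<sigma> (x # xs) \<sigma>' \<longleftrightarrow> (\<exists>\<tau>. step r c \<sigma> x \<tau> \<and> executes r c \<tau> xs \<sigma>')"

definition stored_loads :: "action list \<Rightarrow> load list" where
  "stored_loads xs = [l. Storage l v \<leftarrow> xs]"

definition retrieved_loads :: "action list \<Rightarrow> load list" where
  "retrieved_loads xs = [l. Retrieval l \<leftarrow> xs]"

text \<open>Solutions in general may contain relocations, in either phase.\<close>

definition solution :: "nat \<Rightarrow> nat \<Rightarrow> load list \<Rightarrow> load list \<Rightarrow> action list \<Rightarrow> bool" where
  "solution r c A D xs \<longleftrightarrow>
     executes r c Map.empty xs Map.empty \<and>
     (\<exists>ys zs. xs = ys @ zs \<and>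
        stored_loads ys = A \<and> retrieved_loads ys = [] \<and>
        stored_loads zs = [] \<and> retrieved_loads zs = D)"

definition relocation_free :: "action list \<Rightarrow> bool" where
  "relocation_free xs \<longleftrightarrow> (\<forall>l v. Relocation l v \<notin> set xs)"

definition plan :: "(load \<Rightarrow> cell) \<Rightarrow> load list \<Rightarrow> load list \<Rightarrow> action list" where
  "plan f A D = map (\<lambda>l. Storage l (f l)) A @ map Retrieval D"

text \<open>Running time is measured on a random access machine programmed in a while-language over
  named arrays of natural numbers; a scalar variable is the entry 0 of an array.
  Every elementary operation, memory access and test costs 1. Addition is restricted to
  constants, so the numbers in memory grow by at most a constant in each assignment and the
  unit-cost measure cannot be exploited by computing with very long numbers.\<close>

type_synonym memory = "string \<Rightarrow> nat \<Rightarrow> nat"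

datatype aexp = Const nat | Read string aexp | Plus aexp nat | Minus aexp aexp

datatype bexp = Less aexp aexp | Not bexp | And bexp bexp

datatype com = Skip
  | Assign string aexp aexp
  | Seq com com
  | If bexp com com
  | While bexp com

fun aval :: "aexp \<Rightarrow> memory \<Rightarrow> nat" where
  "aval (Const k) s = k"
| "aval (Read x i) s = s x (aval i s)"
| "aval (Plus a k) s = aval a s + k"
| "aval (Minus a b) s = aval a s - aval b s"

fun bval :: "bexp \<Rightarrow> memory \<Rightarrow> bool" where
  "bval (Less a b) s \<longleftrightarrow> aval a s < aval b s"
| "bval (Not p) s \<longleftrightarrow> \<not> bval p s"
| "bval (And p q) s \<longleftrightarrow> bval p s \<and> bval q s"

fun acost :: "aexp \<Rightarrow> nat" where
  "acost (Const k) = 1"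
| "acost (Read x i) = acost i + 1"
| "acost (Plus a k) = acost a + 1"
| "acost (Minus a b) = acost a + acost b + 1"

fun bcost :: "bexp \<Rightarrow> nat" where
  "bcost (Less a b) = acost a + acost b + 1"
| "bcost (Not p) = bcost p + 1"
| "bcost (And p q) = bcost p + bcost q + 1"

text \<open>\<open>exec p s t s'\<close>: started in memory \<open>s\<close>, the program \<open>p\<close> terminates in memory \<open>s'\<close>
  at total cost \<open>t\<close>. \<open>Assign x i a\<close> is the array update \<open>x[i] := a\<close>.\<close>

inductive exec :: "com \<Rightarrow> memory \<Rightarrow> nat \<Rightarrow> memory \<Rightarrow> bool" where
  Skip: "exec Skip s 1 s"
| Assign: "exec (Assign x i a) s (acost i + acost a + 1)
     (s(x := (s x)(aval i s := aval a s)))"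
| Seq: "\<lbrakk>exec p s t s'; exec q s' t' s''\<rbrakk> \<Longrightarrow> exec (Seq p q) s (t + t') s''"
| IfTrue: "\<lbrakk>bval b s; exec p s t s'\<rbrakk> \<Longrightarrow> exec (If b p q) s (bcost b + t + 1) s'"
| IfFalse: "\<lbrakk>\<not> bval b s; exec q s t s'\<rbrakk> \<Longrightarrow> exec (If b p q) s (bcost b + t + 1) s'"
| WhileFalse: "\<not> bval b s \<Longrightarrow> exec (While b p) s (bcost b + 1) s"
| WhileTrue: "\<lbrakk>bval b s; exec p s t s'; exec (While b p) s' t' s''\<rbrakk>
     \<Longrightarrow> exec (While b p) s (bcost b + t + t' + 1) s''"

definition list_array :: "nat list \<Rightarrow> nat \<Rightarrow> nat" where
  "list_array xs i = (if i < length xs then xs ! i else 0)"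

text \<open>The input is the number of rows, the number of loads and the two sequences; all other
  memory is initially 0.\<close>

definition input :: "nat \<Rightarrow> nat \<Rightarrow> load list \<Rightarrow> load list \<Rightarrow> memory" where
  "input r n A D = (\<lambda>_ _. 0)(''r'' := list_array [r], ''n'' := list_array [n],
     ''A'' := list_array A, ''D'' := list_array D)"

definition output_arrangement :: "memory \<Rightarrow> load \<Rightarrow> cell" where
  "output_arrangement s l = (s ''row'' l, s ''col'' l)"

end

theory Submission
  imports Defs
begin

text \<open>
  Order the loads by departure and, with rank \<open>K\<close>, by reversed arrival. An arrangement works as soon as
  every load outside the front row has a neighbour that departs earlier and a neighbour that arrives
  later, i.e. a smaller one in each of the two orders: descending along such neighbours leads to the
  front row. The rows are filled from the front so that, compared with all remaining loads, the two
  outer loads of the last row are smaller in departure order and the middle one is smaller in \<open>K\<close>.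
  If the minima \<open>a\<close> (departure) and \<open>b\<close> (\<open>K\<close>) of the remaining loads differ, the next row is \<open>a\<close>,
  \<open>b\<close> and the next load to depart. If they coincide, then either the load \<open>x\<close> at the right end of
  the last row has smaller rank than \<open>b\<close> and \<open>b\<close> goes behind \<open>x\<close>, or \<open>x\<close> is moved to the left end of
  the new row, with \<open>b\<close> beside it in the middle, and the next two loads to depart fill the right column.
  Keeping a cursor into each of the two orders makes the total search linear.
\<close>

section \<open>Layouts\<close>

text \<open>\<open>L\<close>, \<open>M\<close>, \<open>R\<close> give the loads of the three columns in the first \<open>i\<close> rows; \<open>S\<close> is the set of
  remaining loads.\<close>

definition layout ::
  "(nat \<Rightarrow> nat) \<Rightarrow> nat \<Rightarrow> (nat \<Rightarrow> load) \<Rightarrow> (nat \<Rightarrow> load) \<Rightarrow> (nat \<Rightarrow> load) \<Rightarrow> load set \<Rightarrow> bool" where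
  "layout K i L M R S \<longleftrightarrow>
     (\<forall>k<i. K (M k) < K (L k) \<and> (L k < M k \<or> R k < M k)) \<and>
     (\<forall>k. Suc k < i \<longrightarrow> L k < L (Suc k) \<and> R k < R (Suc k) \<and> K (M k) < K (M (Suc k)) \<and>
        (K (M (Suc k)) < K (R (Suc k)) \<or> K (R k) < K (R (Suc k)))) \<and>
     (0 < i \<longrightarrow> (\<forall>l\<in>S. L (i - 1) < l \<and> R (i - 1) < l \<and> K (M (i - 1)) < K l) \<and>
        (L (i - 1) < R (i - 1) \<or> (\<forall>l\<in>S. K (R (i - 1)) < K l)))"

definition least_by :: "('a \<Rightarrow> nat) \<Rightarrow> 'a set \<Rightarrow> 'a \<Rightarrow> bool" where
  "least_by f S a \<longleftrightarrow> a \<in> S \<and> (\<forall>l\<in>S - {a}. f a < f l)"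

text \<open>\<open>S\<close> and \<open>S'\<close> are left unrelated: the old last row and the new
  row are compared only through \<open>prev\<close> and the condition on \<open>K r\<close>. This
  lets the shift below use the lemma on a table whose last row has just been altered.\<close>

lemma layout_SucI:
  assumes "layout K i L M R S"
    and prev: "0 < i \<longrightarrow> L (i - 1) < l \<and> R (i - 1) < r \<and> K (M (i - 1)) < K m"
    and "K m < K l" and "l < m \<or> r < m" and "K m < K r \<or> 0 < i \<and> K (R (i - 1)) < K r \<or> i = 0"
    and "\<And>x. x \<in> S' \<Longrightarrow> l < x \<and> r < x \<and> K m < K x"
    and "l < r \<or> (\<forall>x\<in>S'. K r < K x)"
  shows "layout K (Suc i) (L(i := l)) (M(i := m)) (R(i := r)) S'"
proof -
  have 1: "L k < (L(i := l)) (Suc k) \<and> R k < (R(i := r)) (Suc k) \<and> K (M k) < K ((M(i := m)) (Suc k)) \<and>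
        (K ((M(i := m)) (Suc k)) < K ((R(i := r)) (Suc k)) \<or> K (R k) < K ((R(i := r)) (Suc k)))"
    if "Suc k < Suc i" for k
    using that assms(1,5) prev by (cases "Suc k = i") (auto simp: layout_def)
  show ?thesis
    unfolding layout_def
  proof (intro conjI allI impI)
    fix k assume "k < Suc i"
    then show "K ((M(i := m)) k) < K ((L(i := l)) k)"
      "(L(i := l)) k < (M(i := m)) k \<or> (R(i := r)) k < (M(i := m)) k"
      using assms(1,3,4) by (auto simp: layout_def less_Suc_eq)
  qed (use 1 assms(6,7) in auto)
qed

text \<open>As \<open>a\<close> is not minimal in \<open>K\<close>, some other remaining load has
  smaller rank, and \<open>b\<close> has rank at most that: \<open>K b < K a\<close>. So
  \<open>b\<close> is a later arrival beside \<open>a\<close>, and \<open>a\<close> an earlier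
  departure beside \<open>b\<close>. Since \<open>a < d\<close>, the first alternative in the last
  clause of \<open>layout\<close> holds.\<close>

lemma layout_distinct_minima:
  assumes "layout K i L M R S"
    and "least_by id S a" and "\<not> least_by K S a"
    and "inj_on K S"
    and "least_by K (S - {a}) b" and "least_by id (S - {a} - {b}) d"
  shows "layout K (Suc i) (L(i := a)) (M(i := b)) (R(i := d)) (S - {a} - {b} - {d})"
proof -
  obtain l where "l \<in> S" "l \<noteq> a" "K l \<le> K a"
    using assms(2,3) by (fastforce simp: least_by_def)
  moreover from this have "K l \<noteq> K a"
    using assms(2,4) by (auto simp: least_by_def dest: inj_onD)
  moreover have "K b \<le> K l"
    using assms(5) \<open>l \<in> S\<close> \<open>l \<noteq> a\<close> by (cases "l = b") (auto simp: least_by_def less_imp_le)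
  ultimately have "K b < K a"
    by simp
  then show ?thesis
    using assms(1,2,5,6) by (intro layout_SucI[OF assms(1)]) (auto simp: least_by_def layout_def)
qed

text \<open>At the right end \<open>b\<close> is the earlier departure for \<open>m\<close>, and
  \<open>m\<close> is the later arrival for \<open>l\<close>. Here \<open>b < l\<close>, so the last
  clause of \<open>layout\<close> is met by its second alternative: \<open>b\<close> has smaller
  rank than all that remain.\<close>

lemma layout_common_minimum_above:
  assumes "layout K i L M R S"
    and "least_by id S b" and "least_by K S b"
    and "0 < i \<longrightarrow> K (R (i - 1)) < K b"
    and "least_by K (S - {b}) m" and "least_by id (S - {b} - {m}) l"
  shows "layout K (Suc i) (L(i := l)) (M(i := m)) (R(i := b)) (S - {b} - {m} - {l})"
  using assms by (intro layout_SucI[OF assms(1)]) (auto simp: least_by_def layout_def)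

text \<open>Neither \<open>R i\<close> nor any remaining load arrives later than \<open>b\<close>,
  so \<open>b\<close> cannot go behind \<open>R i\<close>; it goes behind \<open>M i\<close>. Moved
  to its left, \<open>R i\<close> gets \<open>b\<close> as later arrival and serves \<open>b\<close>
  as earlier departure. The vacated cell suits \<open>y\<close>: it departs after
  \<open>R i\<close>, and \<open>M i\<close> arrives later.\<close>

lemma layout_common_minimum_shift:
  assumes "layout K (Suc i) L M R S"
    and "least_by id S b" and "least_by K S b"
    and "K b < K (R i)"
    and "least_by id (S - {b}) y" and "least_by id (S - {b} - {y}) z"
  shows "layout K (Suc (Suc i)) (L(Suc i := R i)) (M(Suc i := b)) (R(i := y, Suc i := z))
           (S - {b} - {y} - {z})"
proof -
  have prev: "L i < x" "R i < x" "K (M i) < K x" if "x \<in> S" for x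
    using assms(1) that by (auto simp: layout_def)
  have in_S: "b \<in> S" "y \<in> S" "z \<in> S" and "y < z" "K b < K y" "K b < K z" "b < z"
    using assms(2,3,5,6) by (auto simp: least_by_def)
  have rest: "z < x" "K b < K x" if "x \<in> S - {b} - {y} - {z}" for x
    using assms(3,6) that by (auto simp: least_by_def)
  \<comment> \<open>This is the purpose of the last clause of \<open>layout\<close>: its second
    alternative fails for the remaining load \<open>b\<close>. The inequality keeps the left column
    increasing, and it leaves \<open>L i\<close> as an earlier departure for \<open>M i\<close> once
    \<open>R i\<close> has gone.\<close>
  have "L i < R i"
    using assms(1,3,4) in_S by (auto simp: layout_def)
  have row_below: "R k < R i" if "Suc k = i" for k
    using that assms(1) by (auto simp: layout_def)
  \<comment> \<open>The remaining set is taken empty because \<open>b\<close> departs before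
    \<open>y\<close>, so the altered row is not below all loads still to be placed.\<close>
  have "layout K (Suc i) L M (R(i := y)) {}"
    unfolding layout_def
  proof (intro conjI allI impI)
    fix k assume "k < Suc i"
    then have "K (M k) < K (L k)" "L k < M k \<or> R k < M k"
      using assms(1) by (auto simp: layout_def)
    then show "K (M k) < K (L k)" "L k < M k \<or> (R(i := y)) k < M k"
      using \<open>L i < R i\<close> by (cases "k = i"; auto)+
  next
    fix k assume k: "Suc k < Suc i"
    then show "L k < L (Suc k)" "K (M k) < K (M (Suc k))"
      using assms(1) by (auto simp: layout_def)
    show "(R(i := y)) k < (R(i := y)) (Suc k)"
      using assms(1) k row_below[of k] prev(2)[OF in_S(2)] by (auto simp: layout_def)
    show "K (M (Suc k)) < K ((R(i := y)) (Suc k)) \<or> K ((R(i := y)) k) < K ((R(i := y)) (Suc k))"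
      using assms(1) k prev(3)[OF in_S(2)] by (auto simp: layout_def)
  qed (use prev in_S \<open>L i < R i\<close> in auto)
  then show ?thesis
  proof (rule layout_SucI)
    show "R i < z \<or> (\<forall>x\<in>S - {b} - {y} - {z}. K z < K x)"
      using prev in_S by blast
    show "R i < x \<and> z < x \<and> K b < K x" if "x \<in> S - {b} - {y} - {z}" for x
      using prev rest that by blast
  qed (use prev in_S \<open>L i < R i\<close> \<open>y < z\<close> \<open>K b < K z\<close> assms(4) in auto)
qed

section \<open>Programs with running time\<close>

text \<open>The second argument of the postcondition is the time elapsed since the start, \<open>n\<close> being the
  time already spent before \<open>p\<close>.\<close>

definition wp :: "com \<Rightarrow> (memory \<Rightarrow> nat \<Rightarrow> bool) \<Rightarrow> memory \<Rightarrow> nat \<Rightarrow> bool" where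
  "wp p Q s n \<longleftrightarrow> (\<exists>t s'. exec p s t s' \<and> Q s' (n + t))"

lemma wp_mono: "wp p Q s n \<Longrightarrow> (\<And>s n. Q s n \<Longrightarrow> Q' s n) \<Longrightarrow> wp p Q' s n"
  by (auto simp: wp_def)

lemma wp_Assign:
  "Q (s(x := (s x)(aval i s := aval a s))) (n + acost i + acost a + 1) \<Longrightarrow> wp (Assign x i a) Q s n"
  unfolding wp_def by (force intro: exec.Assign simp: add.assoc)

lemma wp_Seq: "wp p (wp q Q) s n \<Longrightarrow> wp (Seq p q) Q s n"
  unfolding wp_def by (metis exec.Seq add.assoc)

lemma wp_If:
  assumes "bval b s \<Longrightarrow> wp p Q s (n + bcost b + 1)" "\<not> bval b s \<Longrightarrow> wp q Q s (n + bcost b + 1)"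
  shows "wp (If b p q) Q s n"
proof (cases "bval b s")
  case True
  then obtain t s' where "exec p s t s'" "Q s' (n + bcost b + 1 + t)"
    using assms by (auto simp: wp_def)
  then show ?thesis
    using exec.IfTrue[OF True] unfolding wp_def by (force simp: ac_simps)
next
  case False
  then obtain t s' where "exec q s t s'" "Q s' (n + bcost b + 1 + t)"
    using assms by (auto simp: wp_def)
  then show ?thesis
    using exec.IfFalse[OF False] unfolding wp_def by (force simp: ac_simps)
qed

text \<open>Elapsed time is an argument of \<open>I\<close>, so the invariant itself bounds the
  cost; the measure \<open>f\<close> secures termination.\<close>

lemma wp_While:
  fixes f :: "memory \<Rightarrow> nat"
  assumes "I s n"
    and step: "\<And>s n. I s n \<Longrightarrow> bval b s \<Longrightarrow>
      wp p (\<lambda>s' n'. I s' n' \<and> f s' < f s) s (n + bcost b + 1)"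
    and exit: "\<And>s n. I s n \<Longrightarrow> \<not> bval b s \<Longrightarrow> Q s (n + bcost b + 1)"
  shows "wp (While b p) Q s n"
  using \<open>I s n\<close>
proof (induction "f s" arbitrary: s n rule: less_induct)
  case less
  show ?case
  proof (cases "bval b s")
    case True
    then obtain t s' where 1: "exec p s t s'" "I s' (n + bcost b + 1 + t)" "f s' < f s"
      using step less.prems unfolding wp_def by blast
    then obtain t' s'' where "exec (While b p) s' t' s''" "Q s'' (n + bcost b + 1 + t + t')"
      using less.hyps unfolding wp_def by blast
    then show ?thesis
      using exec.WhileTrue[OF True 1(1)] unfolding wp_def by (force simp: ac_simps)
  next
    case False
    then show ?thesis
      using exec.WhileFalse[OF False] exit[OF less.prems False] unfolding wp_def
      by (force simp: ac_simps)
  qed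
qed

abbreviation var :: "string \<Rightarrow> aexp" where "var x \<equiv> Read x (Const 0)"
abbreviation set_var :: "string \<Rightarrow> aexp \<Rightarrow> com" where "set_var x a \<equiv> Assign x (Const 0) a"

section \<open>The program\<close>

definition skip_done :: "aexp \<Rightarrow> string \<Rightarrow> com" where
  "skip_done e x = While (Less (Const 0) (Read ''done'' e)) (set_var x (Plus (var x) 1))"

text \<open>An iteration costs at most 12, the final test at most 7; the additive form of the bound
  avoids truncated subtraction. \<open>g k\<close> is the load inspected at cursor position
  \<open>k\<close>: \<open>k\<close> itself in departure order, \<open>Q k\<close> in the order by
  rank.\<close>

lemma wp_skip_done:
  assumes "x \<noteq> ''done''" and e: "\<And>k. aval e (s(x := (s x)(0 := k))) = g k" and "acost e \<le> 3"
    and "s x 0 \<le> j" and "s ''done'' (g j) = 0"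
    and "\<And>k. s x 0 \<le> k \<Longrightarrow> k < j \<Longrightarrow> 0 < s ''done'' (g k)"
    and post: "\<And>n'. n' + 12 * s x 0 \<le> n + 12 * j + 7 \<Longrightarrow> Q (s(x := (s x)(0 := j))) n'"
  shows "wp (skip_done e x) Q s n"
proof -
  let ?I = "\<lambda>s' n'. \<exists>k. s x 0 \<le> k \<and> k \<le> j \<and> s' = s(x := (s x)(0 := k)) \<and>
     n' + 12 * s x 0 \<le> n + 12 * k"
  show ?thesis unfolding skip_done_def
  proof (rule wp_While[where I = ?I and f = "\<lambda>s. j - s x 0"])
    show "?I s n" using assms(4) by (intro exI[of _ "s x 0"]) auto
  next
    fix s' n' assume "?I s' n'" and b: "bval (Less (Const 0) (Read ''done'' e)) s'"
    then obtain k where k: "s x 0 \<le> k" "k \<le> j" "s' = s(x := (s x)(0 := k))"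
      "n' + 12 * s x 0 \<le> n + 12 * k" by blast
    with b have "0 < s ''done'' (g k)" using assms(1) e by simp
    then have "k < j" using assms(5) k(2) by (cases "k = j") auto
    then show "wp (set_var x (Plus (var x) 1)) (\<lambda>s'' n'. ?I s'' n' \<and> j - s'' x 0 < j - s' x 0)
      s' (n' + bcost (Less (Const 0) (Read ''done'' e)) + 1)"
      using k assms(3) by (intro wp_Assign conjI exI[of _ "Suc k"]) auto
  next
    fix s' n' assume "?I s' n'" and b: "\<not> bval (Less (Const 0) (Read ''done'' e)) s'"
    then obtain k where k: "s x 0 \<le> k" "k \<le> j" "s' = s(x := (s x)(0 := k))"
      "n' + 12 * s x 0 \<le> n + 12 * k" by blast
    with b have "s ''done'' (g k) = 0" using assms(1) e by simp
    then have "k = j" using assms(6)[of k] k by (cases "k = j") auto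
    then show "Q s' (n' + bcost (Less (Const 0) (Read ''done'' e)) + 1)"
      using k assms(3) by (auto intro!: post)
  qed
qed

text \<open>The cell is given by the number \<open>k\<close> of rows in front of the current row and the column \<open>c\<close>.\<close>

definition put :: "aexp \<Rightarrow> nat \<Rightarrow> nat \<Rightarrow> com" where
  "put e k c = Seq (set_var ''v'' e) (Seq (Assign ''done'' (var ''v'') (Const 1))
     (Seq (Assign ''row'' (var ''v'') (Minus (var ''i'') (Const k)))
       (Assign ''col'' (var ''v'') (Const c))))"

lemma wp_put:
  assumes "acost e \<le> 3"
    and "\<And>n'. n' \<le> n + 24 \<Longrightarrow> Q (s(''v'' := (s ''v'')(0 := aval e s),
        ''done'' := (s ''done'')(aval e s := 1),
        ''row'' := (s ''row'')(aval e s := s ''i'' 0 - k),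
        ''col'' := (s ''col'')(aval e s := c))) n'"
  shows "wp (put e k c) Q s n"
  unfolding put_def using assms by (intro wp_Seq wp_Assign) simp

text \<open>\<open>p\<close> and \<open>q\<close> are the cursors into the departure order and into \<open>Q\<close>, the loads sorted by \<open>K\<close>.\<close>

definition front_to_p :: com where "front_to_p = skip_done (var ''p'') ''p''"
definition front_to_q :: com where "front_to_q = skip_done (Read ''Q'' (var ''q'')) ''q''"
definition pick_p :: "nat \<Rightarrow> nat \<Rightarrow> com" where
  "pick_p k c = Seq front_to_p (put (var ''p'') k c)"
definition pick_q :: "nat \<Rightarrow> nat \<Rightarrow> com" where
  "pick_q k c = Seq front_to_q (put (Read ''Q'' (var ''q'')) k c)"

text \<open>\<open>x\<close> holds the load at the right end of the last row. It is 0 at the start, and \<open>K 0 = 0\<close>, so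
  that no shift happens in the front row.\<close>

definition pick_distinct :: com where
  "pick_distinct = Seq (pick_p 0 0) (Seq (pick_q 0 1) (Seq (pick_p 0 2) (set_var ''x'' (var ''v''))))"

text \<open>\<open>x\<close> is saved at once, since the later picks overwrite
  \<open>v\<close>.\<close>

definition pick_above :: com where
  "pick_above = Seq (pick_p 0 2) (Seq (set_var ''x'' (var ''v'')) (Seq (pick_q 0 1) (pick_p 0 0)))"

text \<open>The offset 1 addresses the preceding row, whose right cell \<open>x\<close> has
  vacated.\<close>

definition pick_shift :: com where
  "pick_shift = Seq (put (var ''x'') 0 0) (Seq (pick_p 0 1) (Seq (pick_p 1 2) (Seq (pick_p 0 2)
     (set_var ''x'' (var ''v'')))))"

definition next_row :: com where
  "next_row = Seq (set_var ''i'' (Plus (var ''i'') 1)) (set_var ''j'' (Plus (var ''j'') 3))"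

text \<open>With \<open>Less\<close> as the only comparison, equality of the two minima is tested by
  excluding both strict inequalities. In the inner test \<open>p\<close> then stands for the common
  minimum.\<close>

definition fill_row :: com where
  "fill_row = Seq (Seq front_to_p (Seq front_to_q
     (If (And (Not (Less (var ''p'') (Read ''Q'' (var ''q''))))
              (Not (Less (Read ''Q'' (var ''q'')) (var ''p''))))
       (If (Less (Read ''K'' (var ''x'')) (Read ''K'' (var ''p''))) pick_above pick_shift)
       pick_distinct))) next_row"

definition fill_rows :: com where
  "fill_rows = While (Less (var ''j'') (var ''n'')) fill_row"

text \<open>\<open>A\<close> is indexed from 0 and \<open>k\<close> is incremented first, so the
  last arrival gets rank 1. Rank 0 stays free for the initial value of \<open>x\<close>.\<close>

definition rank_loads :: com where
  "rank_loads = While (Less (var ''k'') (var ''n''))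
     (Seq (set_var ''k'' (Plus (var ''k'') 1))
     (Seq (Assign ''Q'' (var ''k'') (Read ''A'' (Minus (var ''n'') (var ''k''))))
       (Assign ''K'' (Read ''Q'' (var ''k'')) (var ''k''))))"

text \<open>Up to two dummy loads, last in both orders, complete the final row. As they are never
  the smaller neighbour of a proper load, they can be dropped from the arrangement.\<close>

definition pad :: com where
  "pad = Seq (set_var ''k'' (Plus (var ''k'') 1))
     (Seq (Assign ''Q'' (var ''k'') (var ''k'')) (Assign ''K'' (var ''k'') (var ''k'')))"

definition arrange :: com where
  "arrange = Seq rank_loads (Seq pad (Seq pad
     (Seq (set_var ''p'' (Const 1)) (Seq (set_var ''q'' (Const 1)) fill_rows))))"

section \<open>Searching both orders with amortised cost\<close>

locale ranking =
  fixes N :: nat and Q K :: "nat \<Rightarrow> nat"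
  assumes Q: "k \<in> {1..N} \<Longrightarrow> Q k \<in> {1..N} \<and> K (Q k) = k"
    and K: "l \<in> {1..N} \<Longrightarrow> K l \<in> {1..N} \<and> Q (K l) = l"
    and K0: "K 0 = 0"
begin

text \<open>The cursors never pass a remaining load, so each search starts where the previous one
  ended. The bound \<open>Suc N\<close> admits the initial cursor value 1 when
  \<open>N = 0\<close>.\<close>

definition tracks :: "memory \<Rightarrow> load set \<Rightarrow> bool" where
  "tracks s S \<longleftrightarrow> S \<subseteq> {1..N} \<and> s ''Q'' = Q \<and> s ''K'' = K \<and>
     (\<forall>l\<in>{1..N}. s ''done'' l = 0 \<longleftrightarrow> l \<in> S) \<and>
     s ''p'' 0 \<in> {1..Suc N} \<and> s ''q'' 0 \<in> {1..Suc N} \<and> (\<forall>l\<in>S. s ''p'' 0 \<le> l \<and> s ''q'' 0 \<le> K l)"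

text \<open>Each iteration of \<open>skip_done\<close> costs at most 12 and advances a cursor.\<close>

definition credit :: "memory \<Rightarrow> nat" where
  "credit s = 12 * s ''p'' 0 + 12 * s ''q'' 0"

lemma inj_K: "inj_on K {1..N}"
  by (metis K inj_onI)

lemma least_by_id_exists:
  assumes "S \<subseteq> {1..N}" "S \<noteq> {}"
  obtains a where "least_by id S a"
proof -
  have "finite S" using assms(1) finite_subset by blast
  then have "least_by id S (Min S)" using assms(2) by (auto simp: least_by_def order.not_eq_order_implies_strict)
  then show thesis by (rule that)
qed

lemma least_by_K_exists:
  assumes "S \<subseteq> {1..N}" "S \<noteq> {}"
  obtains a where "least_by K S a"
proof -
  have fin: "finite S" using assms(1) finite_subset by blast
  obtain a where a: "a \<in> S" "\<And>l. l \<in> S \<Longrightarrow> K a \<le> K l"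
    using arg_min_if_finite[OF fin assms(2), of K] by (metis not_le)
  have "K a < K l" if "l \<in> S - {a}" for l
    using that a inj_K assms(1) by (metis Diff_iff inj_onD insert_iff le_neq_implies_less subsetD)
  with a(1) have "least_by K S a" by (auto simp: least_by_def)
  then show thesis by (rule that)
qed

text \<open>As departure order is label order, the cursor value is itself a label. Labels from the
  cursor up to \<open>a\<close> are all done. The cost of skipping them is paid by the growth of
  \<open>credit\<close>, leaving 7 for the last test.\<close>

lemma wp_front_to_p:
  assumes "tracks s S" "least_by id S a"
    and "\<And>s' n'. tracks s' S \<Longrightarrow> s' ''p'' 0 = a \<Longrightarrow> (\<forall>y. y \<noteq> ''p'' \<longrightarrow> s' y = s y) \<Longrightarrow>
      n' + credit s \<le> n + credit s' + 7 \<Longrightarrow> P s' n'"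
  shows "wp front_to_p P s n"
  unfolding front_to_p_def
proof (rule wp_skip_done[where j = a and g = "\<lambda>k. k"])
  have a: "a \<in> S" "a \<in> {1..N}"
    using assms(1,2) by (auto simp: tracks_def least_by_def)
  have least: "a \<le> l" if "l \<in> S" for l
    using that assms(2) by (cases "l = a") (auto simp: least_by_def less_imp_le)
  show "s ''p'' 0 \<le> a" "s ''done'' a = 0"
    using a assms(1) by (auto simp: tracks_def)
  show "0 < s ''done'' k" if "s ''p'' 0 \<le> k" "k < a" for k
  proof -
    have "k \<in> {1..N}" using that a assms(1) by (auto simp: tracks_def)
    moreover have "k \<notin> S" using that(2) least by (meson not_le)
    ultimately show ?thesis using assms(1) by (auto simp: tracks_def)
  qed
  fix n' assume "n' + 12 * s ''p'' 0 \<le> n + 12 * a + 7"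
  then show "P (s(''p'' := (s ''p'')(0 := a))) n'"
    using a least assms(1) by (intro assms(3)) (auto simp: tracks_def credit_def)
qed auto

text \<open>This cursor runs over ranks, so the search ends at \<open>K a\<close>; the ranks skipped
  belong to loads already placed.\<close>

lemma wp_front_to_q:
  assumes "tracks s S" "least_by K S a"
    and "\<And>s' n'. tracks s' S \<Longrightarrow> s' ''Q'' (s' ''q'' 0) = a \<Longrightarrow> (\<forall>y. y \<noteq> ''q'' \<longrightarrow> s' y = s y) \<Longrightarrow>
      n' + credit s \<le> n + credit s' + 7 \<Longrightarrow> P s' n'"
  shows "wp front_to_q P s n"
  unfolding front_to_q_def
proof (rule wp_skip_done[where j = "K a" and g = Q])
  have a: "a \<in> S" "a \<in> {1..N}"
    using assms(1,2) by (auto simp: tracks_def least_by_def)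
  then have Ka: "K a \<in> {1..N}" "Q (K a) = a"
    using K by blast+
  have least: "K a \<le> K l" if "l \<in> S" for l
    using that assms(2) by (cases "l = a") (auto simp: least_by_def less_imp_le)
  show "s ''q'' 0 \<le> K a" "s ''done'' (Q (K a)) = 0"
    using a Ka assms(1) by (auto simp: tracks_def)
  show "0 < s ''done'' (Q k)" if "s ''q'' 0 \<le> k" "k < K a" for k
  proof -
    have "k \<in> {1..N}" using that Ka assms(1) by (auto simp: tracks_def)
    then have "Q k \<in> {1..N}" "K (Q k) = k" using Q by auto
    moreover from this have "Q k \<notin> S" using that(2) least by (metis not_le)
    ultimately show ?thesis using assms(1) by (auto simp: tracks_def)
  qed
  fix n' assume "n' + 12 * s ''q'' 0 \<le> n + 12 * K a + 7"
  then show "P (s(''q'' := (s ''q'')(0 := K a))) n'"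
    using a Ka least assms(1) by (intro assms(3)) (auto simp: tracks_def credit_def)
next
  show "aval (Read ''Q'' (var ''q'')) (s(''q'' := (s ''q'')(0 := k))) = Q k" for k
    using assms(1) by (simp add: tracks_def)
qed auto

text \<open>This complements \<open>tracks\<close>: the effect on the output arrays and
  \<open>v\<close>, and the variables left untouched.\<close>

definition placed :: "memory \<Rightarrow> load \<Rightarrow> nat \<Rightarrow> nat \<Rightarrow> memory \<Rightarrow> bool" where
  "placed s a k c s' \<longleftrightarrow> s' ''row'' = (s ''row'')(a := s ''i'' 0 - k) \<and> s' ''col'' = (s ''col'')(a := c) \<and>
     s' ''v'' 0 = a \<and> (\<forall>y\<in>{''i'', ''j'', ''x'', ''n''}. s' y = s y)"

text \<open>The constant 31 is 7 for the final cursor test plus 24 for \<open>put\<close>.\<close>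

lemma wp_pick_p:
  assumes "tracks s S" "least_by id S a"
    and "\<And>s' n'. tracks s' (S - {a}) \<Longrightarrow> placed s a k c s' \<Longrightarrow>
      n' + credit s \<le> n + credit s' + 31 \<Longrightarrow> P s' n'"
  shows "wp (pick_p k c) P s n"
  unfolding pick_p_def
proof (intro wp_Seq wp_front_to_p[OF assms(1,2)] wp_put)
  fix s' n' n''
  assume *: "tracks s' S" "s' ''p'' 0 = a" "\<forall>y. y \<noteq> ''p'' \<longrightarrow> s' y = s y"
    "n' + credit s \<le> n + credit s' + 7" "n'' \<le> n' + 24"
  have "a \<in> S" using assms(2) by (simp add: least_by_def)
  with * show "P (s'(''v'' := (s' ''v'')(0 := aval (var ''p'') s'),
        ''done'' := (s' ''done'')(aval (var ''p'') s' := 1),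
        ''row'' := (s' ''row'')(aval (var ''p'') s' := s' ''i'' 0 - k),
        ''col'' := (s' ''col'')(aval (var ''p'') s' := c))) n''"
    by (intro assms(3)) (auto simp: tracks_def placed_def credit_def)
qed auto

lemma wp_pick_q:
  assumes "tracks s S" "least_by K S a"
    and "\<And>s' n'. tracks s' (S - {a}) \<Longrightarrow> placed s a k c s' \<Longrightarrow>
      n' + credit s \<le> n + credit s' + 31 \<Longrightarrow> P s' n'"
  shows "wp (pick_q k c) P s n"
  unfolding pick_q_def
proof (intro wp_Seq wp_front_to_q[OF assms(1,2)] wp_put)
  fix s' n' n''
  assume *: "tracks s' S" "s' ''Q'' (s' ''q'' 0) = a" "\<forall>y. y \<noteq> ''q'' \<longrightarrow> s' y = s y"
    "n' + credit s \<le> n + credit s' + 7" "n'' \<le> n' + 24"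
  have "a \<in> S" using assms(2) by (simp add: least_by_def)
  with * show "P (s'(''v'' := (s' ''v'')(0 := aval (Read ''Q'' (var ''q'')) s'),
        ''done'' := (s' ''done'')(aval (Read ''Q'' (var ''q'')) s' := 1),
        ''row'' := (s' ''row'')(aval (Read ''Q'' (var ''q'')) s' := s' ''i'' 0 - k),
        ''col'' := (s' ''col'')(aval (Read ''Q'' (var ''q'')) s' := c))) n''"
    by (intro assms(3)) (auto simp: tracks_def placed_def credit_def)
qed auto

section \<open>The table of filled rows and the loop over rows\<close>

definition rows_stored :: "memory \<Rightarrow> nat \<Rightarrow> (nat \<Rightarrow> load) \<Rightarrow> (nat \<Rightarrow> load) \<Rightarrow> (nat \<Rightarrow> load) \<Rightarrow> load set \<Rightarrow> bool" where
  "rows_stored s i L M R S \<longleftrightarrow>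
     (\<forall>k<i. output_arrangement s (L k) = (k, 0) \<and> output_arrangement s (M k) = (k, 1) \<and>
        output_arrangement s (R k) = (k, 2)) \<and>
     L ` {..<i} \<union> M ` {..<i} \<union> R ` {..<i} = {1..N} - S"

text \<open>\<open>j\<close> carries the number of loads placed, \<open>3 * i\<close>, because the
  programs cannot multiply.\<close>

definition invariant :: "memory \<Rightarrow> nat \<Rightarrow> load set \<Rightarrow> bool" where
  "invariant s i S \<longleftrightarrow> tracks s S \<and> card S + 3 * i = N \<and> s ''i'' 0 = i \<and> s ''j'' 0 = 3 * i \<and>
     (\<exists>L M R. layout K i L M R S \<and> rows_stored s i L M R S \<and>
        s ''x'' 0 = (if i = 0 then 0 else R (i - 1)))"

lemma rows_stored_Suc:
  assumes "rows_stored s i L M R S" and "S \<subseteq> {1..N}" and "{l, m, r} \<subseteq> S" and S': "S' = S - {l, m, r}"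
    and "output_arrangement s' l = (i, 0)" "output_arrangement s' m = (i, 1)"
      "output_arrangement s' r = (i, 2)"
    and "\<And>x. x \<notin> {l, m, r} \<Longrightarrow> output_arrangement s' x = output_arrangement s x"
  shows "rows_stored s' (Suc i) (L(i := l)) (M(i := m)) (R(i := r)) S'"
proof -
  have old: "L k \<notin> S" "M k \<notin> S" "R k \<notin> S" if "k < i" for k
    using that assms(1) unfolding rows_stored_def by blast+
  have "(L(i := l)) ` {..<Suc i} = insert l (L ` {..<i})"
    "(M(i := m)) ` {..<Suc i} = insert m (M ` {..<i})"
    "(R(i := r)) ` {..<Suc i} = insert r (R ` {..<i})"
    by (auto simp: lessThan_Suc)
  then have "(L(i := l)) ` {..<Suc i} \<union> (M(i := m)) ` {..<Suc i} \<union> (R(i := r)) ` {..<Suc i} =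
      (L ` {..<i} \<union> M ` {..<i} \<union> R ` {..<i}) \<union> {l, m, r}"
    by auto
  also have "\<dots> = {1..N} - (S - {l, m, r})"
    using assms(1-3) unfolding rows_stored_def by auto
  finally have "(L(i := l)) ` {..<Suc i} \<union> (M(i := m)) ` {..<Suc i} \<union> (R(i := r)) ` {..<Suc i} =
    {1..N} - (S - {l, m, r})" .
  moreover have "L k \<notin> {l, m, r}" "M k \<notin> {l, m, r}" "R k \<notin> {l, m, r}" if "k < i" for k
    using old[OF that] assms(3) by blast+
  ultimately show ?thesis
    using assms(1,5-8) S' unfolding rows_stored_def by (auto simp: less_Suc_eq)
qed

lemma rows_stored_shift:
  assumes "rows_stored s (Suc i) L M R S" and "S \<subseteq> {1..N}" and "{b, y, z} \<subseteq> S" and S': "S' = S - {b, y, z}"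
    and "output_arrangement s' (R i) = (Suc i, 0)" "output_arrangement s' b = (Suc i, 1)"
      "output_arrangement s' y = (i, 2)" "output_arrangement s' z = (Suc i, 2)"
    and "\<And>x. x \<notin> {R i, b, y, z} \<Longrightarrow> output_arrangement s' x = output_arrangement s x"
  shows "rows_stored s' (Suc (Suc i)) (L(Suc i := R i)) (M(Suc i := b)) (R(i := y, Suc i := z)) S'"
proof -
  have old: "L k \<notin> S" "M k \<notin> S" "R k \<notin> S" if "k < Suc i" for k
    using that assms(1) unfolding rows_stored_def by blast+
  \<comment> \<open>Entries of the table are distinct because their output cells are; hence
    overwriting the cell of \<open>R i\<close> disturbs no other entry.\<close>
  have "L k \<noteq> R i" "M k \<noteq> R i" if "k < Suc i" for k
    using that assms(1) unfolding rows_stored_def by (metis lessI prod.inject zero_neq_numeral one_eq_numeral_iff semiring_norm(83))+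
  with old assms(3) have LM: "L k \<notin> {R i, b, y, z}" "M k \<notin> {R i, b, y, z}" if "k < Suc i" for k
    using that by blast+
  have "R k \<noteq> R i" if "k < i" for k
    using that assms(1) unfolding rows_stored_def by (metis lessI less_SucI nat_neq_iff prod.inject)
  with old assms(3) have R: "R k \<notin> {R i, b, y, z}" if "k < i" for k
    using that by (meson insert_iff less_SucI singletonD subsetD)
  have "(L(Suc i := R i)) ` {..<Suc (Suc i)} = insert (R i) (L ` {..<Suc i})"
    "(M(Suc i := b)) ` {..<Suc (Suc i)} = insert b (M ` {..<Suc i})"
    "(R(i := y, Suc i := z)) ` {..<Suc (Suc i)} = {y, z} \<union> R ` {..<i}"
    by (auto simp: lessThan_Suc)
  moreover have "R ` {..<Suc i} = insert (R i) (R ` {..<i})"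
    by (auto simp: lessThan_Suc)
  \<comment> \<open>\<open>R i\<close> only changes columns, so the set of placed loads gains
    exactly \<open>b\<close>, \<open>y\<close> and \<open>z\<close>.\<close>
  ultimately have "(L(Suc i := R i)) ` {..<Suc (Suc i)} \<union> (M(Suc i := b)) ` {..<Suc (Suc i)} \<union>
      (R(i := y, Suc i := z)) ` {..<Suc (Suc i)} =
      (L ` {..<Suc i} \<union> M ` {..<Suc i} \<union> R ` {..<Suc i}) \<union> {b, y, z}"
    by auto
  also have "\<dots> = {1..N} - (S - {b, y, z})"
    using assms(1-3) unfolding rows_stored_def by auto
  finally have "(L(Suc i := R i)) ` {..<Suc (Suc i)} \<union> (M(Suc i := b)) ` {..<Suc (Suc i)} \<union>
      (R(i := y, Suc i := z)) ` {..<Suc (Suc i)} = {1..N} - (S - {b, y, z})" .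
  moreover have "output_arrangement s' ((L(Suc i := R i)) k) = (k, 0)"
    "output_arrangement s' ((M(Suc i := b)) k) = (k, 1)"
    "output_arrangement s' ((R(i := y, Suc i := z)) k) = (k, 2)" if "k < Suc (Suc i)" for k
  proof -
    consider "k < i" | "k = i" | "k = Suc i" using \<open>k < Suc (Suc i)\<close> by linarith
    then show "output_arrangement s' ((L(Suc i := R i)) k) = (k, 0)"
      "output_arrangement s' ((M(Suc i := b)) k) = (k, 1)"
      "output_arrangement s' ((R(i := y, Suc i := z)) k) = (k, 2)"
      using assms(1,5-8) assms(9)[OF LM(1)] assms(9)[OF LM(2)] assms(9)[OF R]
      unfolding rows_stored_def by (cases; auto)+
  qed
  ultimately show ?thesis
    unfolding rows_stored_def S' by blast
qed

text \<open>The state between the picks and \<open>next_row\<close>: the table already has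
  \<open>Suc i\<close> rows while the counters still show the old row. The allowance 200 is
  generous; the dearest branch, \<open>pick_shift\<close>, needs 24 + 3 * 31 + 4 beyond the
  credit.\<close>

definition almost_filled :: "nat \<Rightarrow> memory \<Rightarrow> nat \<Rightarrow> memory \<Rightarrow> nat \<Rightarrow> bool" where
  "almost_filled i s n s' n' \<longleftrightarrow> (\<exists>L M R S'. tracks s' S' \<and> card S' + 3 * Suc i = N \<and>
     layout K (Suc i) L M R S' \<and> rows_stored s' (Suc i) L M R S' \<and>
     s' ''x'' 0 = R i \<and> s' ''i'' = s ''i'' \<and> s' ''j'' = s ''j'' \<and> s' ''n'' = s ''n'' \<and>
     n' + credit s \<le> n + credit s' + 200)"

lemma almost_filledI:
  assumes "tracks s' S'" "card S' + 3 * Suc i = N" "layout K (Suc i) L M R S'"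
    "rows_stored s' (Suc i) L M R S'" "s' ''x'' 0 = R i" "\<forall>y\<in>{''i'', ''j'', ''n''}. s' y = s y"
    "n' + credit s \<le> n + credit s' + 200"
  shows "almost_filled i s n s' n'"
  using assms unfolding almost_filled_def by blast

lemma card_removed:
  assumes "finite S" "card S + 3 * i = N" "u \<in> S" "v \<in> S - {u}" "w \<in> S - {u} - {v}"
  shows "card (S - {u} - {v} - {w}) + 3 * Suc i = N"
proof -
  have "card {u, v, w} = 3" "{u, v, w} \<subseteq> S" using assms by auto
  then have "card (S - {u, v, w}) = card S - 3" "3 \<le> card S"
    using assms(1) by (metis card_Diff_subset finite_subset, metis card_mono)
  moreover have "S - {u, v, w} = S - {u} - {v} - {w}" by blast
  ultimately show ?thesis using assms(2) by simp
qed

lemma wp_pick_distinct: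
  assumes "tracks s S" "card S + 3 * i = N" "s ''i'' 0 = i"
    and "layout K i L M R S" "rows_stored s i L M R S"
    and a: "least_by id S a" "\<not> least_by K S a"
    and b: "least_by K (S - {a}) b" and d: "least_by id (S - {a} - {b}) d"
  shows "wp pick_distinct (almost_filled i s n) s n"
  unfolding pick_distinct_def
proof (rule wp_Seq, rule wp_pick_p[OF assms(1) a(1)], rule wp_Seq, rule wp_pick_q[OF _ b], assumption,
    rule wp_Seq, rule wp_pick_p[OF _ d], assumption, rule wp_Assign)
  fix s1 n1 s2 n2 s3 n3
  assume *: "tracks s3 (S - {a} - {b} - {d})" "placed s a 0 0 s1" "placed s1 b 0 1 s2" "placed s2 d 0 2 s3"
    "n1 + credit s \<le> n + credit s1 + 31" "n2 + credit s1 \<le> n1 + credit s2 + 31"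
    "n3 + credit s2 \<le> n2 + credit s3 + 31"
  let ?s = "s3(''x'' := (s3 ''x'')(aval (Const 0) s3 := aval (var ''v'') s3))"
  have S: "S \<subseteq> {1..N}" "finite S" using assms(1) finite_subset by (auto simp: tracks_def)
  have mem: "a \<in> S" "b \<in> S - {a}" "d \<in> S - {a} - {b}"
    using a b d by (auto simp: least_by_def)
  have rows: "rows_stored ?s (Suc i) (L(i := a)) (M(i := b)) (R(i := d)) (S - {a} - {b} - {d})"
    using mem * assms(3)
    by (intro rows_stored_Suc[OF assms(5) S(1)]) (auto simp: placed_def output_arrangement_def)
  have tracks: "tracks ?s (S - {a} - {b} - {d})"
    using *(1) by (simp add: tracks_def)
  show "almost_filled i s n ?s (n3 + acost (Const 0) + acost (var ''v'') + 1)"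
    by (rule almost_filledI[OF tracks card_removed[OF S(2) assms(2) mem]
          layout_distinct_minima[OF assms(4) a inj_on_subset[OF inj_K S(1)] b d] rows])
      (use * in \<open>auto simp: placed_def credit_def\<close>)
qed

lemma wp_pick_above:
  assumes "tracks s S" "card S + 3 * i = N" "s ''i'' 0 = i"
    and "layout K i L M R S" "rows_stored s i L M R S"
    and b: "least_by id S b" "least_by K S b" and below: "0 < i \<longrightarrow> K (R (i - 1)) < K b"
    and m: "least_by K (S - {b}) m" and l: "least_by id (S - {b} - {m}) l"
  shows "wp pick_above (almost_filled i s n) s n"
  unfolding pick_above_def
proof (rule wp_Seq, rule wp_pick_p[OF assms(1) b(1)], rule wp_Seq, rule wp_Assign, rule wp_Seq,
    rule wp_pick_q[OF _ m])
  fix s1 n1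
  let ?s = "s1(''x'' := (s1 ''x'')(aval (Const 0) s1 := aval (var ''v'') s1))"
  assume *: "tracks s1 (S - {b})" "placed s b 0 2 s1" "n1 + credit s \<le> n + credit s1 + 31"
  show "tracks ?s (S - {b})" using *(1) by (simp add: tracks_def)
  fix s2 n2
  assume **: "tracks s2 (S - {b} - {m})" "placed ?s m 0 1 s2"
    "n2 + credit ?s \<le> n1 + acost (Const 0) + acost (var ''v'') + 1 + credit s2 + 31"
  show "wp (pick_p 0 0) (almost_filled i s n) s2 n2"
  proof (rule wp_pick_p[OF **(1) l])
    fix s3 n3
    assume ***: "tracks s3 (S - {b} - {m} - {l})" "placed s2 l 0 0 s3"
      "n3 + credit s2 \<le> n2 + credit s3 + 31"
    have S: "S \<subseteq> {1..N}" "finite S" using assms(1) finite_subset by (auto simp: tracks_def)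
    have mem: "b \<in> S" "m \<in> S - {b}" "l \<in> S - {b} - {m}"
      using b m l by (auto simp: least_by_def)
    have rows: "rows_stored s3 (Suc i) (L(i := l)) (M(i := m)) (R(i := b)) (S - {b} - {m} - {l})"
      using mem * ** *** assms(3)
      by (intro rows_stored_Suc[OF assms(5) S(1)]) (auto simp: placed_def output_arrangement_def)
    show "almost_filled i s n s3 n3"
      by (rule almost_filledI[OF ***(1) card_removed[OF S(2) assms(2) mem]
            layout_common_minimum_above[OF assms(4) b below m l] rows])
        (use * ** *** in \<open>auto simp: placed_def credit_def\<close>)
  qed
qed

lemma wp_pick_shift:
  assumes "tracks s S" "card S + 3 * Suc i = N" "s ''i'' 0 = Suc i" "s ''x'' 0 = R i"
    and "layout K (Suc i) L M R S" "rows_stored s (Suc i) L M R S"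
    and b: "least_by id S b" "least_by K S b" and below: "K b < K (R i)"
    and y: "least_by id (S - {b}) y" and z: "least_by id (S - {b} - {y}) z"
  shows "wp pick_shift (almost_filled (Suc i) s n) s n"
  unfolding pick_shift_def
proof (rule wp_Seq, rule wp_put)
  fix n0 assume n0: "n0 \<le> n + 24"
  let ?x = "aval (var ''x'') s"
  let ?s = "s(''v'' := (s ''v'')(0 := ?x), ''done'' := (s ''done'')(?x := 1),
        ''row'' := (s ''row'')(?x := s ''i'' 0 - 0), ''col'' := (s ''col'')(?x := 0))"
  have "R i \<in> {1..N} - S" using assms(6) unfolding rows_stored_def by blast
  \<comment> \<open>\<open>R i\<close> was already marked done, so marking it again leaves the
    remaining set unchanged.\<close>
  then have tracks0: "tracks ?s S" using assms(1,4) by (auto simp: tracks_def)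
  show "wp (Seq (pick_p 0 1) (Seq (pick_p 1 2) (Seq (pick_p 0 2) (set_var ''x'' (var ''v'')))))
    (almost_filled (Suc i) s n) ?s n0"
  proof (rule wp_Seq, rule wp_pick_p[OF tracks0 b(1)], rule wp_Seq, rule wp_pick_p[OF _ y], assumption,
      rule wp_Seq, rule wp_pick_p[OF _ z], assumption, rule wp_Assign)
    fix s1 n1 s2 n2 s3 n3
    assume *: "tracks s3 (S - {b} - {y} - {z})" "placed ?s b 0 1 s1" "placed s1 y 1 2 s2" "placed s2 z 0 2 s3"
      "n1 + credit ?s \<le> n0 + credit s1 + 31" "n2 + credit s1 \<le> n1 + credit s2 + 31"
      "n3 + credit s2 \<le> n2 + credit s3 + 31"
    let ?t = "s3(''x'' := (s3 ''x'')(aval (Const 0) s3 := aval (var ''v'') s3))"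
    let ?L = "L(Suc i := R i)" and ?M = "M(Suc i := b)" and ?R = "R(i := y, Suc i := z)"
    have S: "S \<subseteq> {1..N}" "finite S" using assms(1) finite_subset by (auto simp: tracks_def)
    have mem: "b \<in> S" "y \<in> S - {b}" "z \<in> S - {b} - {y}"
      using b y z by (auto simp: least_by_def)
    have rows: "rows_stored ?t (Suc (Suc i)) ?L ?M ?R (S - {b} - {y} - {z})"
      using mem * assms(3,4) \<open>R i \<in> {1..N} - S\<close>
      by (intro rows_stored_shift[OF assms(6) S(1)]) (auto simp: placed_def output_arrangement_def)
    have tracks: "tracks ?t (S - {b} - {y} - {z})"
      using *(1) by (simp add: tracks_def)
    show "almost_filled (Suc i) s n ?t (n3 + acost (Const 0) + acost (var ''v'') + 1)"
      by (rule almost_filledI[OF tracks card_removed[OF S(2) assms(2) mem]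
            layout_common_minimum_shift[OF assms(5) b below y z] rows])
        (use * n0 in \<open>auto simp: placed_def credit_def\<close>)
  qed
qed simp

lemma wp_fill_row:
  assumes inv: "invariant s i S" and "3 \<le> card S"
  shows "wp fill_row (\<lambda>s' n'. (\<exists>S'. invariant s' (Suc i) S') \<and> s' ''n'' = s ''n'' \<and>
      n' + credit s \<le> n + credit s' + 300) s n"
proof -
  obtain L M R where tracks: "tracks s S" and card: "card S + 3 * i = N"
    and ij: "s ''i'' 0 = i" "s ''j'' 0 = 3 * i"
    and layout: "layout K i L M R S" and rows: "rows_stored s i L M R S"
    and x: "s ''x'' 0 = (if i = 0 then 0 else R (i - 1))"
    using inv unfolding invariant_def by blast
  have S: "S \<subseteq> {1..N}" using tracks by (simp add: tracks_def)
  have S': "S - A \<subseteq> {1..N}" "S - A - B \<subseteq> {1..N}" for A B using S by blast+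
  have nonempty: "S \<noteq> {}" "S - {u} \<noteq> {}" "S - {u} - {v} \<noteq> {}" for u v
  proof -
    have "card {u, v} < card S"
      using \<open>3 \<le> card S\<close> by (cases "u = v") auto
    then have "\<not> S \<subseteq> {u, v}"
      by (meson card_mono finite.emptyI finite_insert not_le)
    then show "S \<noteq> {}" "S - {u} \<noteq> {}" "S - {u} - {v} \<noteq> {}"
      by blast+
  qed
  obtain a where a: "least_by id S a" using least_by_id_exists[OF S nonempty(1)] .
  obtain b where b: "least_by K S b" using least_by_K_exists[OF S nonempty(1)] .
  have next_row: "wp next_row (\<lambda>s' n'. (\<exists>S'. invariant s' (Suc i) S') \<and> s' ''n'' = s ''n'' \<and>
      n' + credit s \<le> n + credit s' + 300) s1 n1"
    if filled: "almost_filled i s2 n2 s1 n1" and eq: "s2 ''i'' = s ''i''" "s2 ''j'' = s ''j''" "s2 ''n'' = s ''n''"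
      "n2 + credit s \<le> n + credit s2 + 50" for s1 n1 s2 n2
  proof -
    obtain L M R S' where *: "tracks s1 S'" "card S' + 3 * Suc i = N" "layout K (Suc i) L M R S'"
      "rows_stored s1 (Suc i) L M R S'" "s1 ''x'' 0 = R i" "s1 ''i'' = s ''i''" "s1 ''j'' = s ''j''"
      "s1 ''n'' = s ''n''" "n1 + credit s2 \<le> n2 + credit s1 + 200"
      using filled unfolding almost_filled_def eq(1-3) by blast
    let ?s = "s1(''i'' := (s1 ''i'')(0 := Suc i), ''j'' := (s1 ''j'')(0 := 3 * i + 3))"
    have "tracks ?s S'" "rows_stored ?s (Suc i) L M R S'"
      using *(1,4) by (simp_all add: tracks_def rows_stored_def output_arrangement_def)
    then have inv': "\<exists>S'. invariant ?s (Suc i) S'"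
      using *(2,3,5) unfolding invariant_def
      by (intro exI[of _ S'] conjI, simp_all) blast
    have state: "s1(''i'' := (s1 ''i'')(aval (Const 0) s1 := aval (Plus (var ''i'') 1) s1),
        ''j'' := (s1 ''j'')(0 := s1 ''j'' 0 + 3)) = ?s"
      using *(6,7) ij by simp
    have time: "n1 + credit s \<le> n + credit s1 + 250"
      using *(9) eq(4) by linarith
    have "credit ?s = credit s1" by (simp add: credit_def)
    then show ?thesis
      unfolding next_row_def using inv' time state *(8)
      by (intro wp_Seq wp_Assign) simp
  qed
  have branch: "wp (If (And (Not (Less (var ''p'') (Read ''Q'' (var ''q''))))
              (Not (Less (Read ''Q'' (var ''q'')) (var ''p''))))
       (If (Less (Read ''K'' (var ''x'')) (Read ''K'' (var ''p''))) pick_above pick_shift)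
       pick_distinct) (wp next_row (\<lambda>s' n'. (\<exists>S'. invariant s' (Suc i) S') \<and> s' ''n'' = s ''n'' \<and>
      n' + credit s \<le> n + credit s' + 300)) s2 n2"
    if s2: "tracks s2 S" "s2 ''p'' 0 = a" "s2 ''Q'' (s2 ''q'' 0) = b"
      "\<forall>y. y \<noteq> ''p'' \<and> y \<noteq> ''q'' \<longrightarrow> s2 y = s y" "n2 + credit s \<le> n + credit s2 + 14" for s2 n2
  proof -
    let ?P = "wp next_row (\<lambda>s' n'. (\<exists>S'. invariant s' (Suc i) S') \<and> s' ''n'' = s ''n'' \<and>
      n' + credit s \<le> n + credit s' + 300)"
    have rows2: "rows_stored s2 i L M R S"
      using rows s2(4) by (simp add: rows_stored_def output_arrangement_def)
    have eq: "s2 ''i'' = s ''i''" "s2 ''j'' = s ''j''" "s2 ''n'' = s ''n''"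
      and x2: "s2 ''x'' = s ''x''" and K2: "s2 ''K'' = K"
      using s2(1,4) by (auto simp: tracks_def)
    have i2: "s2 ''i'' 0 = i" using ij eq by simp
    have next2: "?P s3 n4" if "almost_filled i s2 n3 s3 n4" "n3 \<le> n2 + 30" for s3 n3 n4
      using next_row[OF that(1) eq] that(2) s2(5) by simp
    have above: "wp pick_above ?P s2 n3" if "n3 \<le> n2 + 30" "b = a" "K (s ''x'' 0) < K a" for n3
    proof -
      have below: "0 < i \<longrightarrow> K (R (i - 1)) < K a" using x that(3) by auto
      have b: "least_by K S a" using b that(2) by simp
      obtain m where m: "least_by K (S - {a}) m"
        using least_by_K_exists[OF S'(1) nonempty(2)] .
      obtain l where l: "least_by id (S - {a} - {m}) l"
        using least_by_id_exists[OF S'(2) nonempty(3)] .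
      show ?thesis
        using wp_pick_above[OF s2(1) card i2 layout rows2 a b below m l]
        by (rule wp_mono) (rule next2[OF _ that(1)])
    qed
    have shift: "wp pick_shift ?P s2 n3" if "n3 \<le> n2 + 30" "b = a" "\<not> K (s ''x'' 0) < K a" for n3
    proof -
      have "a \<in> {1..N}" using a S by (auto simp: least_by_def)
      then have "0 < K a" using K by fastforce
      \<comment> \<open>In the front row \<open>x\<close> is 0 and \<open>K 0 = 0 < K a\<close>, so
        the test would have succeeded; a shift always has a row in front of it.\<close>
      with that(3) x K0 obtain k where k: "i = Suc k" by (cases i) auto
      \<comment> \<open>\<open>R k\<close> is placed and \<open>a\<close> is not, so injectivity of
        \<open>K\<close> turns the failed test into a strict inequality.\<close>
      have "R k \<in> {1..N} - S" using rows k unfolding rows_stored_def by blast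
      then have "K (R k) \<noteq> K a"
        using a \<open>a \<in> {1..N}\<close> inj_K by (metis DiffE inj_onD least_by_def)
      then have below: "K a < K (R k)" using that(3) x k by simp
      have b: "least_by K S a" using b that(2) by simp
      obtain y where y: "least_by id (S - {a}) y"
        using least_by_id_exists[OF S'(1) nonempty(2)] .
      obtain z where z: "least_by id (S - {a} - {y}) z"
        using least_by_id_exists[OF S'(2) nonempty(3)] .
      have "s2 ''x'' 0 = R k" using x2 x k by simp
      from wp_pick_shift[OF s2(1) card[unfolded k] i2[unfolded k] this layout[unfolded k]
            rows2[unfolded k] a b below y z]
      show ?thesis
        by (rule wp_mono) (rule next2[OF _ that(1)], simp only: k)
    qed
    have distinct: "wp pick_distinct ?P s2 n3" if "n3 \<le> n2 + 30" "b \<noteq> a" for n3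
    proof -
      have na: "\<not> least_by K S a"
        using b that(2) unfolding least_by_def by (metis Diff_iff less_asym singletonD)
      obtain c where c: "least_by K (S - {a}) c"
        using least_by_K_exists[OF S'(1) nonempty(2)] .
      obtain d where d: "least_by id (S - {a} - {c}) d"
        using least_by_id_exists[OF S'(2) nonempty(3)] .
      show ?thesis
        using wp_pick_distinct[OF s2(1) card i2 layout rows2 a na c d]
        by (rule wp_mono) (rule next2[OF _ that(1)])
    qed
    show ?thesis
      using s2(2,3) x2 K2 by (intro wp_If above shift distinct) auto
  qed
  show ?thesis
    unfolding fill_row_def
  proof (rule wp_Seq, rule wp_Seq, rule wp_front_to_p[OF tracks a], rule wp_Seq,
      rule wp_front_to_q[OF _ b], assumption, rule branch)
  qed auto
qed

text \<open>Per row, 306 is 300 for \<open>fill_row\<close> plus 6 for the loop test. The loop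
  compares \<open>j\<close> with \<open>n\<close> rather than \<open>N\<close>; since
  \<open>j\<close> and \<open>N\<close> are multiples of 3 and \<open>N < n + 3\<close>, it stops
  exactly at \<open>N\<close>.\<close>

lemma wp_fill_rows:
  assumes "invariant s 0 {1..N}" and N: "s ''n'' 0 \<le> N" "N < s ''n'' 0 + 3" "3 dvd N"
  shows "wp fill_rows (\<lambda>s' n'. invariant s' (N div 3) {} \<and> n' \<le> n + 126 * N + 30) s n"
  unfolding fill_rows_def
proof (rule wp_While[where f = "\<lambda>s'. N - s' ''i'' 0"
      and I = "\<lambda>s' n'. \<exists>i S. invariant s' i S \<and> s' ''n'' = s ''n'' \<and>
        n' + credit s \<le> n + credit s' + 306 * i"])
  show "\<exists>i S. invariant s i S \<and> s ''n'' = s ''n'' \<and> n + credit s \<le> n + credit s + 306 * i"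
    using assms(1) by (intro exI[of _ 0] exI[of _ "{1..N}"]) simp
next
  fix s1 n1
  assume "\<exists>i S. invariant s1 i S \<and> s1 ''n'' = s ''n'' \<and> n1 + credit s \<le> n + credit s1 + 306 * i"
    and test: "bval (Less (var ''j'') (var ''n'')) s1"
  then obtain i S where inv: "invariant s1 i S" and n1: "s1 ''n'' = s ''n''"
    "n1 + credit s \<le> n + credit s1 + 306 * i" by blast
  have i: "card S + 3 * i = N" "s1 ''i'' 0 = i" "s1 ''j'' 0 = 3 * i"
    using inv by (auto simp: invariant_def)
  then have "3 * i < N" using test n1 N by simp
  \<comment> \<open>\<open>card S\<close> is a positive multiple of 3, so a whole row can always be
    filled.\<close>
  with N(3) i(1) have "3 \<le> card S" "i < N" by (auto elim!: dvdE)
  show "wp fill_row (\<lambda>s' n'. (\<exists>i S. invariant s' i S \<and> s' ''n'' = s ''n'' \<and>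
      n' + credit s \<le> n + credit s' + 306 * i) \<and> N - s' ''i'' 0 < N - s1 ''i'' 0)
    s1 (n1 + bcost (Less (var ''j'') (var ''n'')) + 1)"
    using wp_fill_row[OF inv \<open>3 \<le> card S\<close>]
  proof (rule wp_mono, intro conjI)
    fix s2 n2
    assume *: "(\<exists>S'. invariant s2 (Suc i) S') \<and> s2 ''n'' = s1 ''n'' \<and>
      n2 + credit s1 \<le> n1 + bcost (Less (var ''j'') (var ''n'')) + 1 + credit s2 + 300"
    with n1 show "\<exists>i S. invariant s2 i S \<and> s2 ''n'' = s ''n'' \<and>
      n2 + credit s \<le> n + credit s2 + 306 * i"
      by (intro exI[of _ "Suc i"]) auto
    show "N - s2 ''i'' 0 < N - s1 ''i'' 0"
      using * i \<open>i < N\<close> by (auto simp: invariant_def)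
  qed
next
  fix s1 n1
  assume "\<exists>i S. invariant s1 i S \<and> s1 ''n'' = s ''n'' \<and> n1 + credit s \<le> n + credit s1 + 306 * i"
    and test: "\<not> bval (Less (var ''j'') (var ''n'')) s1"
  then obtain i S where inv: "invariant s1 i S" and n1: "s1 ''n'' = s ''n''"
    "n1 + credit s \<le> n + credit s1 + 306 * i" by blast
  have i: "card S + 3 * i = N" "s1 ''j'' 0 = 3 * i" and tracks: "tracks s1 S"
    using inv by (auto simp: invariant_def)
  then have "s ''n'' 0 \<le> 3 * i" using test n1 by simp
  with N i(1) have Ni: "N = 3 * i" by (auto elim!: dvdE)
  moreover have "finite S" using tracks finite_subset by (auto simp: tracks_def)
  ultimately have "S = {}" using i(1) by simp
  \<comment> \<open>With \<open>N = 3 * i\<close>, the rows cost \<open>102 * N\<close> and the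
    credit adds at most \<open>24 * N + 24\<close>; the last test costs 6.\<close>
  have "credit s1 \<le> 24 * N + 24"
    using tracks by (simp add: tracks_def credit_def)
  then show "invariant s1 (N div 3) {} \<and> n1 + bcost (Less (var ''j'') (var ''n'')) + 1 \<le> n + 126 * N + 30"
    using inv n1(2) Ni \<open>S = {}\<close> by simp
qed

end

section \<open>Ranks by reversed arrival, completed by dummy loads\<close>

definition load_of_rank :: "load list \<Rightarrow> nat \<Rightarrow> load" where
  "load_of_rank A m = (if m \<le> length A then A ! (length A - m) else m)"

lemma load_of_rank_le:
  assumes "set A = {1..length A}" "1 \<le> m" "m \<le> length A"
  shows "1 \<le> load_of_rank A m \<and> load_of_rank A m \<le> length A"
proof -
  have "length A - m < length A" using assms(2,3) by simp
  from nth_mem[OF this] show ?thesis using assms by (simp add: load_of_rank_def)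
qed

text \<open>Up to \<open>length A\<close> the map reads the distinct list \<open>A\<close>
  backwards; beyond, it is the identity, with values above every proper label.\<close>

lemma inj_load_of_rank:
  assumes "distinct A" "set A = {1..length A}"
  shows "inj_on (load_of_rank A) {1..}"
proof (rule inj_onI)
  fix m m' assume *: "m \<in> {1..}" "m' \<in> {1..}" and eq: "load_of_rank A m = load_of_rank A m'"
  show "m = m'"
  proof (cases "m \<le> length A \<and> m' \<le> length A")
    case True
    then have "length A - m < length A" "length A - m' < length A"
      using * by auto
    then have "length A - m = length A - m'"
      using True * eq assms(1) nth_eq_iff_index_eq[of A "length A - m" "length A - m'"]
      by (simp add: load_of_rank_def)
    then show ?thesis using True by linarith
  next
    case False
    then show ?thesis
      using * eq load_of_rank_le[OF assms(2), of m] load_of_rank_le[OF assms(2), of m']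
      by (auto simp: load_of_rank_def split: if_splits)
  qed
qed

lemma load_of_rank_image:
  assumes "distinct A" "set A = {1..length A}" "length A \<le> N"
  shows "load_of_rank A ` {1..N} = {1..N}"
proof (rule endo_inj_surj)
  show "load_of_rank A ` {1..N} \<subseteq> {1..N}"
  proof (rule image_subsetI)
    fix m assume "m \<in> {1..N}"
    then show "load_of_rank A m \<in> {1..N}"
      using assms(3) load_of_rank_le[OF assms(2), of m]
      by (cases "m \<le> length A") (auto simp: load_of_rank_def)
  qed
  show "inj_on (load_of_rank A) {1..N}"
    using inj_load_of_rank[OF assms(1,2)] by (rule inj_on_subset) auto
qed simp

definition ranked :: "load list \<Rightarrow> memory \<Rightarrow> nat \<Rightarrow> memory \<Rightarrow> bool" where
  "ranked A s k s' \<longleftrightarrow> s' ''k'' 0 = k \<and> (\<forall>y. y \<notin> {''k'', ''Q'', ''K''} \<longrightarrow> s' y = s y) \<and> s' ''K'' 0 = 0 \<and>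
     (\<forall>m\<in>{1..k}. s' ''Q'' m = load_of_rank A m \<and> s' ''K'' (load_of_rank A m) = m)"

lemma ranked_Suc:
  assumes "ranked A s k s1" "distinct A" "set A = {1..length A}"
    and l: "l = load_of_rank A (Suc k)"
  shows "ranked A s (Suc k) (s1(''k'' := (s1 ''k'')(0 := Suc k), ''Q'' := (s1 ''Q'')(Suc k := l),
    ''K'' := (s1 ''K'')(l := Suc k)))" (is "ranked A s (Suc k) ?s")
proof -
  have old: "s1 ''Q'' m = load_of_rank A m" "s1 ''K'' (load_of_rank A m) = m" if "m \<in> {1..k}" for m
    using that assms(1) unfolding ranked_def by blast+
  have neq: "load_of_rank A m \<noteq> l" if "m \<in> {1..k}" for m
    using inj_onD[OF inj_load_of_rank[OF assms(2,3)], of m "Suc k"] that l by auto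
  have "?s ''Q'' m = load_of_rank A m \<and> ?s ''K'' (load_of_rank A m) = m" if "m \<in> {1..Suc k}" for m
    using that old[of m] neq[of m] l by (cases "m = Suc k") auto
  \<comment> \<open>The write to \<open>K\<close> therefore spares entry 0. The bound
    \<open>length A + Suc k\<close> is chosen to exceed both \<open>length A\<close> and the rank in
    question.\<close>
  moreover have "l \<noteq> 0"
    using load_of_rank_image[OF assms(2,3), of "length A + Suc k"] l by fastforce
  moreover have "\<forall>y. y \<notin> {''k'', ''Q'', ''K''} \<longrightarrow> s1 y = s y" "s1 ''K'' 0 = 0"
    using assms(1) unfolding ranked_def by blast+
  ultimately show ?thesis
    unfolding ranked_def by simp
qed

lemma wp_rank_loads:
  assumes A: "distinct A" "set A = {1..length A}"
    and s: "s ''n'' 0 = length A" "s ''A'' = list_array A" "s ''k'' 0 = 0" "s ''K'' 0 = 0"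
    and post: "\<And>s' t'. ranked A s (length A) s' \<Longrightarrow> t' \<le> t + 30 * length A + 6 \<Longrightarrow> P s' t'"
  shows "wp rank_loads P s t"
  unfolding rank_loads_def
proof (rule wp_While[where f = "\<lambda>s'. length A - s' ''k'' 0"
      and I = "\<lambda>s' t'. \<exists>k\<le>length A. ranked A s k s' \<and> t' \<le> t + 30 * k"])
  show "\<exists>k\<le>length A. ranked A s k s \<and> t \<le> t + 30 * k"
    using s by (intro exI[of _ 0]) (auto simp: ranked_def)
  fix s1 t1
  assume "\<exists>k\<le>length A. ranked A s k s1 \<and> t1 \<le> t + 30 * k"
  then obtain k where k: "k \<le> length A" "ranked A s k s1" "t1 \<le> t + 30 * k" by blast
  have s1: "s1 ''k'' 0 = k" "s1 ''n'' 0 = length A" "s1 ''A'' = list_array A"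
    using k(2) s by (simp_all add: ranked_def)
  show "P s1 (t1 + bcost (Less (var ''k'') (var ''n'')) + 1)"
    if "\<not> bval (Less (var ''k'') (var ''n'')) s1"
    using that s1 k by (intro post) auto
  assume "bval (Less (var ''k'') (var ''n'')) s1"
  then have "k < length A" using s1 by simp
  then have l: "load_of_rank A (Suc k) = A ! (length A - Suc k)" "length A - Suc k < length A"
    by (auto simp: load_of_rank_def)
  let ?s = "s1(''k'' := (s1 ''k'')(0 := Suc k), ''Q'' := (s1 ''Q'')(Suc k := A ! (length A - Suc k)),
    ''K'' := (s1 ''K'')(A ! (length A - Suc k) := Suc k))"
  have "ranked A s (Suc k) ?s"
    by (rule ranked_Suc[OF k(2) A l(1)[symmetric]])
  then show "wp (Seq (set_var ''k'' (Plus (var ''k'') 1))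
     (Seq (Assign ''Q'' (var ''k'') (Read ''A'' (Minus (var ''n'') (var ''k''))))
       (Assign ''K'' (Read ''Q'' (var ''k'')) (var ''k''))))
    (\<lambda>s' t'. (\<exists>k\<le>length A. ranked A s k s' \<and> t' \<le> t + 30 * k) \<and>
      length A - s' ''k'' 0 < length A - s1 ''k'' 0)
    s1 (t1 + bcost (Less (var ''k'') (var ''n'')) + 1)"
    using s1 l(2) k(3) \<open>k < length A\<close>
    by (intro wp_Seq wp_Assign conjI exI[of _ "Suc k"]) (simp_all add: list_array_def)
qed

lemma wp_pad:
  assumes "ranked A s k s1" "distinct A" "set A = {1..length A}" "length A \<le> k"
    and "\<And>s' t'. ranked A s (Suc k) s' \<Longrightarrow> t' \<le> t + 20 \<Longrightarrow> P s' t'"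
  shows "wp pad P s1 t"
proof -
  have "Suc k = load_of_rank A (Suc k)" using assms(4) by (simp add: load_of_rank_def)
  from assms(5)[OF ranked_Suc[OF assms(1-3) this]]
  have "P (s1(''k'' := (s1 ''k'')(0 := Suc k), ''Q'' := (s1 ''Q'')(Suc k := Suc k),
    ''K'' := (s1 ''K'')(Suc k := Suc k))) t'" if "t' \<le> t + 20" for t'
    using that by blast
  moreover have "s1 ''k'' 0 = k" using assms(1) by (simp add: ranked_def)
  ultimately show ?thesis
    unfolding pad_def by (intro wp_Seq wp_Assign) simp
qed

text \<open>\<open>N\<close> is \<open>n\<close> rounded up to a multiple of 3, hence at most
  \<open>n + 2\<close>, and two runs of \<open>pad\<close> supply every rank up to
  \<open>N\<close>.\<close>

lemma wp_arrange:
  assumes A: "distinct A" "set A = {1..n}" and N: "N = 3 * ((n + 2) div 3)"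
  shows "wp arrange (\<lambda>s t. t \<le> 200 * n + 500 \<and> (\<exists>K L M R. ranking N (load_of_rank A) K \<and>
    layout K (N div 3) L M R {} \<and> ranking.rows_stored N s (N div 3) L M R {})) (input r n A D) 0"
  (is "wp arrange ?P ?s 0")
proof -
  have len: "length A = n" using distinct_card[OF A(1)] A(2) by simp
  then have A': "set A = {1..length A}" using A(2) by simp
  have s: "?s ''n'' 0 = length A" "?s ''A'' = list_array A" "?s ''k'' 0 = 0" "?s ''K'' 0 = 0"
    using len by (auto simp: input_def list_array_def)
  have N': "n \<le> N" "N < n + 3" "3 dvd N" using N by auto
  have rows: "wp fill_rows ?P s2 t2"
    if ranked: "ranked A ?s (Suc (Suc n)) s1" and t: "t2 \<le> 30 * n + 100"
      and s2: "s2 = s1(''p'' := (s1 ''p'')(0 := 1), ''q'' := (s1 ''q'')(0 := 1))" for s1 s2 t2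
  proof -
    have r: "s1 ''Q'' m = load_of_rank A m" "s1 ''K'' (load_of_rank A m) = m" if "m \<in> {1..N}" for m
      using that ranked N'(2) unfolding ranked_def by auto
    have s1: "s1 ''K'' 0 = 0" "s1 ''done'' = ?s ''done''" "s1 ''i'' = ?s ''i''" "s1 ''j'' = ?s ''j''"
      "s1 ''x'' = ?s ''x''" "s1 ''n'' = ?s ''n''"
      using ranked unfolding ranked_def by simp_all
    have image: "load_of_rank A ` {1..N} = {1..N}"
      using load_of_rank_image[OF A(1) A'] len N'(1) by simp
    have Q: "s1 ''Q'' k \<in> {1..N} \<and> s1 ''K'' (s1 ''Q'' k) = k" if "k \<in> {1..N}" for k
    proof -
      have "load_of_rank A k \<in> load_of_rank A ` {1..N}" using that by blast
      then have "load_of_rank A k \<in> {1..N}" using image by simp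
      then show ?thesis using r[OF that] by simp
    qed
    have inverse: "s1 ''K'' l \<in> {1..N} \<and> s1 ''Q'' (s1 ''K'' l) = l \<and> load_of_rank A (s1 ''K'' l) = l"
      if "l \<in> {1..N}" for l
    proof -
      have "l \<in> load_of_rank A ` {1..N}" using image that by simp
      then obtain m where "m \<in> {1..N}" "l = load_of_rank A m" by blast
      then show ?thesis using r[of m] by simp
    qed
    interpret ranking N "s1 ''Q''" "s1 ''K''"
      by standard (use Q inverse s1(1) in \<open>simp_all only:\<close>)
    have "1 \<le> s1 ''K'' l" if "l \<in> {1..N}" for l
      using K[OF that] by simp
    then have "tracks s2 {1..N}"
      using s1(2) by (simp add: tracks_def s2 input_def)
    moreover have "layout (s1 ''K'') 0 L M R {1..N}" "rows_stored s2 0 L M R {1..N}" for L M R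
      by (simp_all add: layout_def rows_stored_def)
    moreover have "s2 ''i'' 0 = 0" "s2 ''j'' 0 = 0" "s2 ''x'' 0 = 0"
      using s1(3-5) by (simp_all add: s2 input_def)
    ultimately have "invariant s2 0 {1..N}"
      unfolding invariant_def by simp
    moreover have "s2 ''n'' 0 = n" using s1(6) s(1) len s2 by simp
    ultimately have "wp fill_rows (\<lambda>s' n'. invariant s' (N div 3) {} \<and> n' \<le> t2 + 126 * N + 30) s2 t2"
      using N' by (intro wp_fill_rows) simp_all
    then show ?thesis
    proof (rule wp_mono)
      fix s3 t3 assume *: "invariant s3 (N div 3) {} \<and> t3 \<le> t2 + 126 * N + 30"
      then obtain L M R where "layout (s1 ''K'') (N div 3) L M R {}" "rows_stored s3 (N div 3) L M R {}"
        unfolding invariant_def by blast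
      moreover have "ranking N (load_of_rank A) (s1 ''K'')"
      proof (rule ranking.intro)
        show "load_of_rank A k \<in> {1..N} \<and> s1 ''K'' (load_of_rank A k) = k" if "k \<in> {1..N}" for k
          using Q[OF that] r[OF that] by simp
        show "s1 ''K'' l \<in> {1..N} \<and> load_of_rank A (s1 ''K'' l) = l" if "l \<in> {1..N}" for l
          using inverse[OF that] by simp
      qed (rule s1(1))
      \<comment> \<open>The preparation takes at most \<open>30 * n + 100\<close>; with
        \<open>N\<close> at most \<open>n + 2\<close> the sum is at most
        \<open>156 * n + 382\<close>.\<close>
      moreover have "t3 \<le> 200 * n + 500"
        using * t N'(2) by linarith
      ultimately show "?P s3 t3"
        by blast
    qed
  qed
  have cursors: "wp (Seq (set_var ''p'' (Const 1)) (Seq (set_var ''q'' (Const 1)) fill_rows)) ?P s1 t1"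
    if ranked: "ranked A ?s (Suc (Suc n)) s1" and "t1 \<le> 30 * n + 50" for s1 t1
  proof (rule wp_Seq, rule wp_Assign, rule wp_Seq, rule wp_Assign, rule rows[OF ranked])
  qed (use that(2) in simp_all)
  show ?thesis
    unfolding arrange_def
  proof (rule wp_Seq, rule wp_rank_loads[OF A(1) A' s], rule wp_Seq)
    fix s1 t1 assume 1: "ranked A ?s (length A) s1" "t1 \<le> 0 + 30 * length A + 6"
    show "wp pad (wp (Seq pad (Seq (set_var ''p'' (Const 1)) (Seq (set_var ''q'' (Const 1)) fill_rows))) ?P) s1 t1"
    proof (rule wp_pad[OF 1(1) A(1) A' order.refl], rule wp_Seq)
      fix s2 t2 assume 2: "ranked A ?s (Suc (length A)) s2" "t2 \<le> t1 + 20"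
      show "wp pad (wp (Seq (set_var ''p'' (Const 1)) (Seq (set_var ''q'' (Const 1)) fill_rows)) ?P) s2 t2"
        by (rule wp_pad[OF 2(1) A(1) A'], simp, rule cursors) (use 1(2) 2(2) len in simp_all)
    qed
  qed
qed

section \<open>Paths\<close>

lemma reachable_refl: "u \<in> S \<Longrightarrow> reachable S u u"
  unfolding reachable_def by (intro exI[of _ "[u]"]) auto

lemma reachable_step:
  assumes "u \<in> S" "adjacent u v" "reachable S v w"
  shows "reachable S u w"
proof -
  obtain p where "p \<noteq> []" "hd p = v" "last p = w" "set p \<subseteq> S" "successively adjacent p"
    using assms(3) by (auto simp: reachable_def)
  then show ?thesis
    using assms(1,2) unfolding reachable_def
    by (intro exI[of _ "u # p"]) (cases p; auto)
qed

lemma reachable_mono: "reachable S u v \<Longrightarrow> S \<subseteq> T \<Longrightarrow> reachable T u v"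
  unfolding reachable_def by blast

lemma adjacent_sym: "adjacent u v \<Longrightarrow> adjacent v u"
  by (cases u; cases v) auto

lemma reachable_sym:
  assumes "reachable S u v"
  shows "reachable S v u"
proof -
  obtain p where "p \<noteq> []" "hd p = u" "last p = v" "set p \<subseteq> S" "successively adjacent p"
    using assms by (auto simp: reachable_def)
  moreover from this have "successively adjacent (rev p)"
    by (auto simp: successively_rev intro: successively_mono adjacent_sym)
  ultimately show ?thesis
    unfolding reachable_def by (intro exI[of _ "rev p"]) (auto simp: hd_rev last_rev)
qed

text \<open>Each step to a smaller neighbour lowers \<open>rank\<close>, so the descent ends in the
  front row. Confining the path to cells of rank at most \<open>rank l\<close> is the point: with
  reversed arrival these cells are still empty at storage, with labels they are vacated before
  retrieval, apart from the load's own cell.\<close>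

lemma reachable_front:
  fixes rank :: "load \<Rightarrow> nat"
  assumes area: "\<And>l. l \<in> X \<Longrightarrow> f l \<in> area r c"
    and descent: "\<And>l. l \<in> X \<Longrightarrow> fst (f l) = 0 \<or> (\<exists>l'\<in>X. adjacent (f l) (f l') \<and> rank l' < rank l)"
    and "l \<in> X"
  shows "\<exists>e\<in>front_row r c. reachable (f ` {l' \<in> X. rank l' \<le> rank l}) (f l) e"
  using \<open>l \<in> X\<close>
proof (induction "rank l" arbitrary: l rule: less_induct)
  case less
  from descent[OF less.prems] show ?case
  proof
    assume "fst (f l) = 0"
    then show ?thesis
      using area less.prems by (intro bexI[of _ "f l"] reachable_refl) (auto simp: front_row_def)
  next
    assume "\<exists>l'\<in>X. adjacent (f l) (f l') \<and> rank l' < rank l"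
    then obtain l' where l': "l' \<in> X" "adjacent (f l) (f l')" "rank l' < rank l" by blast
    then obtain e where e: "e \<in> front_row r c" "reachable (f ` {m \<in> X. rank m \<le> rank l'}) (f l') e"
      using less.hyps by blast
    have "reachable (f ` {m \<in> X. rank m \<le> rank l}) (f l') e"
      using e(2) by (rule reachable_mono) (use l'(3) in auto)
    then show ?thesis
      using e(1) l'(2) less.prems by (intro bexI[of _ e] reachable_step[of "f l" _ "f l'"]) auto
  qed
qed

section \<open>Solutions from arrangements\<close>

definition stored :: "(load \<Rightarrow> cell) \<Rightarrow> load set \<Rightarrow> config" where
  "stored f X = (\<lambda>l. if l \<in> X then Some (f l) else None)"

lemma ran_stored: "ran (stored f X) = f ` X"
  by (force simp: stored_def ran_def)

lemma dom_stored: "dom (stored f X) = X"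
  by (auto simp: stored_def split: if_splits)

lemma executes_snoc:
  "executes r c \<sigma> xs \<tau> \<Longrightarrow> step r c \<tau> x \<rho> \<Longrightarrow> executes r c \<sigma> (xs @ [x]) \<rho>"
  by (induction xs arbitrary: \<sigma>) auto

lemma executes_append:
  "executes r c \<sigma> xs \<tau> \<Longrightarrow> executes r c \<tau> ys \<rho> \<Longrightarrow> executes r c \<sigma> (xs @ ys) \<rho>"
  by (induction xs arbitrary: \<sigma>) auto

lemma executes_storage:
  assumes "distinct A"
    and "\<And>m. m < length A \<Longrightarrow> \<exists>e\<in>front_row r c. reachable (area r c - f ` set (take m A)) (f (A ! m)) e"
  shows "executes r c Map.empty (map (\<lambda>l. Storage l (f l)) A) (stored f (set A))"
  using assms
proof (induction A rule: rev_induct)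
  case Nil
  then show ?case by (auto simp: stored_def)
next
  case (snoc a A)
  have "executes r c Map.empty (map (\<lambda>l. Storage l (f l)) A) (stored f (set A))"
  proof (rule snoc.IH)
    show "\<exists>e\<in>front_row r c. reachable (area r c - f ` set (take m A)) (f (A ! m)) e"
      if "m < length A" for m
      using snoc.prems(2)[of m] that by (auto simp: nth_append)
  qed (use snoc.prems in simp)
  \<comment> \<open>The assumed path leads out of the area; storage runs it backwards.\<close>
  moreover obtain e where "e \<in> front_row r c" "reachable (area r c - f ` set A) e (f a)"
    using snoc.prems(2)[of "length A"] by (auto dest: reachable_sym)
  then have "step r c (stored f (set A)) (Storage a (f a)) ((stored f (set A))(a \<mapsto> f a))"
    using snoc.prems(1) by (intro step.Storage) (auto simp: empty_cells_def ran_stored dom_stored)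
  moreover have "(stored f (set A))(a \<mapsto> f a) = stored f (set (A @ [a]))"
    by (auto simp: stored_def)
  ultimately show ?case
    by (auto intro: executes_snoc)
qed

text \<open>When \<open>l\<close> leaves, exactly the loads \<open>l\<close> to \<open>n\<close> are
  present, and \<open>l\<close> may pass through its own cell.\<close>

lemma executes_retrieval:
  assumes "\<And>l. l \<in> {1..n} \<Longrightarrow>
      \<exists>e\<in>front_row r c. reachable (insert (f l) (area r c - f ` {l..n})) (f l) e"
    and "m \<le> n"
  shows "executes r c (stored f {1..n}) (map Retrieval [1..<m + 1]) (stored f {m<..n})"
  using \<open>m \<le> n\<close>
proof (induction m)
  case 0
  then show ?case by (auto simp: stored_def)
next
  case (Suc m)
  obtain e where "e \<in> front_row r c"
    "reachable (insert (f (Suc m)) (area r c - f ` {Suc m..n})) (f (Suc m)) e"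
    using assms(1)[of "Suc m"] Suc.prems by auto
  moreover have "{m<..n} = {Suc m..n}" by auto
  ultimately have "step r c (stored f {m<..n}) (Retrieval (Suc m)) ((stored f {m<..n})(Suc m := None))"
    using Suc.prems by (intro step.Retrieval) (auto simp: empty_cells_def ran_stored, auto simp: stored_def)
  moreover have "(stored f {m<..n})(Suc m := None) = stored f {Suc m<..n}"
    by (auto simp: stored_def)
  ultimately have "executes r c (stored f {1..n}) (map Retrieval [1..<m + 1] @ [Retrieval (Suc m)])
      (stored f {Suc m<..n})"
    using Suc.IH Suc.prems by (intro executes_snoc) auto
  then show ?case by simp
qed

text \<open>As \<open>K (A ! m) = n - m\<close>, smaller rank means later arrival. Descent by
  \<open>K\<close> gives the storage paths, descent by label the retrieval paths.\<close>

lemma solution_plan: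
  assumes A: "distinct A" "set A = {1..n}"
    and area: "\<And>l. l \<in> {1..n} \<Longrightarrow> f l \<in> area r c" and inj: "inj_on f {1..n}"
    and departs: "\<And>l. l \<in> {1..n} \<Longrightarrow>
      fst (f l) = 0 \<or> (\<exists>l'\<in>{1..n}. adjacent (f l) (f l') \<and> l' < l)"
    and arrives: "\<And>l. l \<in> {1..n} \<Longrightarrow>
      fst (f l) = 0 \<or> (\<exists>l'\<in>{1..n}. adjacent (f l) (f l') \<and> K l' < K l)"
    and K: "\<And>m. m < n \<Longrightarrow> K (A ! m) = n - m"
  shows "solution r c A [1..<n + 1] (plan f A [1..<n + 1])"
proof -
  have len: "length A = n" using distinct_card[OF A(1)] A(2) by simp
  have "executes r c Map.empty (map (\<lambda>l. Storage l (f l)) A) (stored f {1..n})"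
    unfolding A(2)[symmetric]
  proof (rule executes_storage[OF A(1)])
    fix m assume m: "m < length A"
    have mem: "A ! m \<in> {1..n}" using m A(2) nth_mem by blast
    have "f ` {l' \<in> {1..n}. K l' \<le> K (A ! m)} \<subseteq> area r c - f ` set (take m A)"
    proof (intro image_subsetI DiffI notI)
      fix l assume l: "l \<in> {l' \<in> {1..n}. K l' \<le> K (A ! m)}"
      then show "f l \<in> area r c" using area by blast
      assume "f l \<in> f ` set (take m A)"
      moreover have "set (take m A) \<subseteq> {1..n}" using A(2) set_take_subset by fastforce
      ultimately have "l \<in> set (take m A)"
        using l inj by (auto dest: inj_onD)
      then obtain j where "j < m" "l = A ! j"
        using m by (auto simp: in_set_conv_nth)
      then show False using l K[of j] K[of m] m len by auto
    qed
    then show "\<exists>e\<in>front_row r c. reachable (area r c - f ` set (take m A)) (f (A ! m)) e"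
      using reachable_front[of "{1..n}" f r c K, OF area arrives mem] reachable_mono by blast
  qed
  moreover have "executes r c (stored f {1..n}) (map Retrieval [1..<n + 1]) (stored f {n<..n})"
  proof (rule executes_retrieval)
    fix l assume l: "l \<in> {1..n}"
    have "f ` {l' \<in> {1..n}. id l' \<le> id l} \<subseteq> insert (f l) (area r c - f ` {l..n})"
    proof (rule image_subsetI)
      fix m assume m: "m \<in> {l' \<in> {1..n}. id l' \<le> id l}"
      have "f m \<notin> f ` {l..n}" if "m \<noteq> l"
        using that m l inj by (auto dest!: inj_onD)
      then show "f m \<in> insert (f l) (area r c - f ` {l..n})"
        using m area by auto
    qed
    moreover have "fst (f m) = 0 \<or> (\<exists>l'\<in>{1..n}. adjacent (f m) (f l') \<and> id l' < id m)"
      if "m \<in> {1..n}" for m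
      using departs[OF that] by simp
    then obtain e where "e \<in> front_row r c" "reachable (f ` {l' \<in> {1..n}. id l' \<le> id l}) (f l) e"
      using reachable_front[of "{1..n}" f r c id, OF area _ l] by blast
    ultimately show "\<exists>e\<in>front_row r c. reachable (insert (f l) (area r c - f ` {l..n})) (f l) e"
      using reachable_mono by blast
  qed simp
  moreover have "stored f {n<..n} = Map.empty" by (simp add: stored_def)
  ultimately have "executes r c Map.empty (plan f A [1..<n + 1]) Map.empty"
    unfolding plan_def by (metis executes_append)
  moreover have "stored_loads (map (\<lambda>l. Storage l (f l)) xs) = xs"
    "retrieved_loads (map (\<lambda>l. Storage l (f l)) xs) = []"
    "stored_loads (map Retrieval xs) = []" "retrieved_loads (map Retrieval xs) = xs" for xs
    by (induction xs) (auto simp: stored_loads_def retrieved_loads_def)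
  ultimately show ?thesis
    unfolding solution_def plan_def by blast
qed

text \<open>The clauses of \<open>layout\<close> supply both smaller neighbours: in front, in the
  outer columns for departure and in the middle for arrival; beside, for the other order. Only at
  the right end may the later arrival be either beside or in front.\<close>

lemma solution_of_layout:
  assumes A: "distinct A" "set A = {1..n}" and N: "N = 3 * ((n + 2) div 3)" and "n \<le> 3 * r"
    and ranking: "ranking N (load_of_rank A) K"
    and layout: "layout K (N div 3) L M R {}"
    and rows: "ranking.rows_stored N s (N div 3) L M R {}"
  shows "solution r 3 A [1..<n + 1] (plan (output_arrangement s) A [1..<n + 1])"
proof -
  interpret ranking N "load_of_rank A" K by (rule ranking)
  let ?f = "output_arrangement s" and ?i = "N div 3"
  have len: "length A = n" using distinct_card[OF A(1)] A(2) by simp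
  have f: "?f (L k) = (k, 0)" "?f (M k) = (k, 1)" "?f (R k) = (k, 2)" if "k < ?i" for k
    using rows that unfolding rows_stored_def by blast+
  have loads: "L ` {..<?i} \<union> M ` {..<?i} \<union> R ` {..<?i} = {1..N}"
    using rows unfolding rows_stored_def by simp
  then have mem: "L k \<in> {1..N}" "M k \<in> {1..N}" "R k \<in> {1..N}" if "k < ?i" for k
    using that by blast+
  have cell: thesis
    if "l \<in> {1..N}" "\<And>k. k < ?i \<Longrightarrow> l = L k \<Longrightarrow> thesis" "\<And>k. k < ?i \<Longrightarrow> l = M k \<Longrightarrow> thesis"
      "\<And>k. k < ?i \<Longrightarrow> l = R k \<Longrightarrow> thesis" for l thesis
    using that loads by blast
  have "?i \<le> r" using N \<open>n \<le> 3 * r\<close> by auto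
  have area: "?f l \<in> area r 3" if "l \<in> {1..N}" for l
    using that f \<open>?i \<le> r\<close> by (elim cell) (auto simp: area_def)
  have inj: "inj_on ?f {1..N}"
  proof (rule inj_on_inverseI)
    \<comment> \<open>A left inverse of the arrangement: the load is read off from its row and
      column.\<close>
    show "(\<lambda>(k, j). if j = 0 then L k else if j = 1 then M k else R k) (?f l) = l" if "l \<in> {1..N}" for l
      using that f by (elim cell) auto
  qed
  have row: "K (M k) < K (L k)" "L k < M k \<or> R k < M k" if "k < ?i" for k
    using layout that by (auto simp: layout_def)
  have column: "L k < L (Suc k)" "R k < R (Suc k)" "K (M k) < K (M (Suc k))"
    "K (M (Suc k)) < K (R (Suc k)) \<or> K (R k) < K (R (Suc k))" if "Suc k < ?i" for k
    using layout that by (auto simp: layout_def)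
  have departs: "fst (?f l) = 0 \<or> (\<exists>l'\<in>{1..N}. adjacent (?f l) (?f l') \<and> l' < l)" if "l \<in> {1..N}" for l
  proof (rule cell[OF that])
    fix k assume k: "k < ?i" "l = L k"
    show ?thesis
    proof (cases k)
      case (Suc j)
      then show ?thesis using k f[of j] f[of k] mem[of j] column(1)[of j]
        by (intro disjI2 bexI[of _ "L j"]) auto
    qed (use k f in simp)
  next
    fix k assume k: "k < ?i" "l = M k"
    show ?thesis
      using row(2)[OF k(1)]
    proof
      assume "L k < M k"
      then show ?thesis using k f[of k] mem[of k] by (intro disjI2 bexI[of _ "L k"]) auto
    next
      assume "R k < M k"
      then show ?thesis using k f[of k] mem[of k] by (intro disjI2 bexI[of _ "R k"]) auto
    qed
  next
    fix k assume k: "k < ?i" "l = R k"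
    show ?thesis
    proof (cases k)
      case (Suc j)
      then show ?thesis using k f[of j] f[of k] mem[of j] column(2)[of j]
        by (intro disjI2 bexI[of _ "R j"]) auto
    qed (use k f in simp)
  qed
  have arrives: "fst (?f l) = 0 \<or> (\<exists>l'\<in>{1..N}. adjacent (?f l) (?f l') \<and> K l' < K l)" if "l \<in> {1..N}" for l
  proof (rule cell[OF that])
    fix k assume k: "k < ?i" "l = L k"
    then show ?thesis using f[of k] mem[of k] row(1)[of k] by (intro disjI2 bexI[of _ "M k"]) auto
  next
    fix k assume k: "k < ?i" "l = M k"
    show ?thesis
    proof (cases k)
      case (Suc j)
      then show ?thesis using k f[of j] f[of k] mem[of j] column(3)[of j]
        by (intro disjI2 bexI[of _ "M j"]) auto
    qed (use k f in simp)
  next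
    fix k assume k: "k < ?i" "l = R k"
    show ?thesis
    proof (cases k)
      case (Suc j)
      with k have "K (M k) < K (R k) \<or> K (R j) < K (R k)" using column(4)[of j] by simp
      then show ?thesis
      proof
        assume "K (M k) < K (R k)"
        then show ?thesis using k f[of k] mem[of k] by (intro disjI2 bexI[of _ "M k"]) auto
      next
        assume "K (R j) < K (R k)"
        then show ?thesis using k Suc f[of j] f[of k] mem[of j] by (intro disjI2 bexI[of _ "R j"]) auto
      qed
    qed (use k f in simp)
  qed
  \<comment> \<open>It remains to drop the dummies: their labels and ranks exceed \<open>n\<close>,
    so a smaller neighbour of a proper load is proper in either order.\<close>
  have nN: "n \<le> N" using N by auto
  then have sub: "l \<in> {1..N}" if "l \<in> {1..n}" for l using that by auto
  have K_A: "K (A ! m) = n - m" if "m < n" for m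
  proof -
    have "n - m \<in> {1..N}" "load_of_rank A (n - m) = A ! m"
      using that nN len by (auto simp: load_of_rank_def)
    then show ?thesis using Q[of "n - m"] by simp
  qed
  have K_le: "K l \<le> n" if "l \<in> {1..n}" for l
    using that A(2) len K_A by (metis diff_le_self in_set_conv_nth)
  have K_gt: "n < K l" if "l \<in> {1..N}" "\<not> l \<le> n" for l
    using Q[OF that(1)] that(2) len by (simp add: load_of_rank_def)
  show ?thesis
  proof (rule solution_plan[where K = K, OF A])
    show "inj_on ?f {1..n}" using inj by (rule inj_on_subset) (use sub in blast)
    fix l assume l: "l \<in> {1..n}"
    show "?f l \<in> area r 3" using area sub l by blast
    show "fst (?f l) = 0 \<or> (\<exists>l'\<in>{1..n}. adjacent (?f l) (?f l') \<and> l' < l)"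
      using departs[OF sub[OF l]] l by fastforce
    have "l' \<in> {1..n}" if "l' \<in> {1..N}" "K l' < K l" for l'
      using that K_le[OF l] K_gt[OF that(1)] by force
    then show "fst (?f l) = 0 \<or> (\<exists>l'\<in>{1..n}. adjacent (?f l) (?f l') \<and> K l' < K l)"
      using arrives[OF sub[OF l]] by blast
  qed (rule K_A)
qed

section \<open>Existence of solutions and linear running time\<close>

theorem theorem1:
  "(\<forall>r n :: nat. \<forall>A :: nat list.
      r \<ge> 1 \<and> n \<le> 3 * r \<and> distinct A \<and> set A = {1..n} \<longrightarrow>
        (\<exists>xs. solution r 3 A [1..<n+1] xs \<and> relocation_free xs \<and> length xs = 2 * n)) \<and>
   (\<exists>(prog :: com) (T :: nat \<Rightarrow> nat).
      (\<lambda>n. real (T n)) \<in> O(\<lambda>n. real n) \<and>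
      (\<forall>r n :: nat. \<forall>A :: nat list.
        r \<ge> 1 \<and> n \<le> 3 * r \<and> distinct A \<and> set A = {1..n} \<longrightarrow>
          (\<exists>t s xs. exec prog (input r n A [1..<n+1]) t s \<and> t \<le> T n \<and>
             xs = plan (output_arrangement s) A [1..<n+1] \<and>
             solution r 3 A [1..<n+1] xs \<and> relocation_free xs \<and> length xs = 2 * n)))"
proof -
  have main: "\<exists>t s xs. exec arrange (input r n A [1..<n+1]) t s \<and> t \<le> 200 * n + 1000 \<and>
             xs = plan (output_arrangement s) A [1..<n+1] \<and>
             solution r 3 A [1..<n+1] xs \<and> relocation_free xs \<and> length xs = 2 * n"
    if n: "n \<le> 3 * r" and A: "distinct A" "set A = {1..n}" for r n and A :: "nat list"
  proof -
    obtain t s K L M R where s: "exec arrange (input r n A [1..<n+1]) t s" "t \<le> 200 * n + 1000"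
      and K: "ranking (3 * ((n + 2) div 3)) (load_of_rank A) K"
        "layout K (3 * ((n + 2) div 3) div 3) L M R {}"
        "ranking.rows_stored (3 * ((n + 2) div 3)) s (3 * ((n + 2) div 3) div 3) L M R {}"
      using wp_arrange[OF A refl, of r "[1..<n+1]"] unfolding wp_def by auto
    have "length A = n" using distinct_card[OF A(1)] A(2) by simp
    then show ?thesis
      using s solution_of_layout[OF A refl n K]
      by (intro exI[of _ t] exI[of _ s]) (auto simp: plan_def relocation_free_def)
  qed
  have "(\<lambda>n. real (200 * n + 1000)) \<in> O(\<lambda>n. real n)"
    \<comment> \<open>From \<open>n = 1\<close> on, \<open>200 * n + 1000\<close> is at most
      \<open>1200 * n\<close>.\<close>
    by (rule bigoI[of _ 1200]) (auto intro!: eventually_at_top_linorderI[of 1])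
  with main show ?thesis
    by (intro conjI exI[of _ arrange] exI[of _ "\<lambda>n. 200 * n + 1000"] allI impI; blast)
qed

end
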